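(* Let $A$ be an $m\times n$ matrix, $b\in\mathbb{R}^m$, $\mu_1,\mu_2>0$, and let $$\varphi(x):=\tfrac12\|Ax-b\|_2^2+\mu_1\|x\|_1-\mu_2\|x\|_2^2,\qquad g(x):=\mu_1\|x\|_1-\mu_2\|x\|_2^2,\quad x\in\mathbb{R}^n.$$ Let $\bar x$ be such that $0\in\partial\varphi(\bar x)$, and let $\partial\varphi$ be metrically regular around $(\bar x,0)$. Then: (1) $g$ is prox-bounded on $\mathbb{R}^n$ and continuously prox-regular at $\bar x$ for $-A^*A\bar x+A^*b$; there is a neighborhood $U'\times V'$ of $(\bar x,0)$ such that for every $(x,v)\in\mathrm{gph}\,\partial\varphi\cap(U'\times V')$ there exists $d\in\mathbb{R}^n$ with $-v\in\partial^2\varphi(x,v)(d)$; and $\partial\varphi$ is semismooth$^*$ at $(\bar x,0)$. (2) For any $\gamma\in\big(0,\frac1{2\mu_2}\big)$ such that $I-\gamma A^*A$ is nonsingular, the following algorithm is well-defined for all starting points $x^0$ in some neighborhood of $\bar x$, and the sequence of its iterates $\{x^k\}$ $Q$-superlinearly converges to $\bar x$. For $k=0,1,\ldots$: if $0\in\partial\varphi(x^k)$, stop; otherwise compute $u^k:=x^k-\gamma(A^*Ax^k-A^*b)$ and $v^k:=\mathrm{Prox}_{\gamma g}(u^k)$, choose $d^k\in\mathbb{R}^n$ such that $$-\tfrac1\gamma(x^k-v^k)-A^*Ad^k\in\partial^2g\Big(v^k,\tfrac1\gamma(u^k-v^k)\Big)(x^k-v^k+d^k),$$ and set $x^{k+1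}:=x^k+d^k$.
   Context: For $\Omega\subset\mathbb{R}^s$ and $\bar z\in\Omega$: $\widehat N_\Omega(\bar z)=\{v:\limsup_{z\to\bar z,\,z\in\Omega}\frac{\langle v,z-\bar z\rangle}{\|z-\bar z\|}\le 0\}$; $N_\Omega(\bar z)=\{v:\exists\, z_k\to\bar z,\ z_k\in\Omega,\ v_k\to v,\ v_k\in\widehat N_\Omega(z_k)\}$; and for $d\in\mathbb{R}^s$, $N_\Omega(\bar z;d)=\{v:\exists\,t_k\downarrow0,\ d_k\to d,\ v_k\to v,\ v_k\in\widehat N_\Omega(\bar z+t_kd_k)\}$. For $F\colon\mathbb{R}^n\rightrightarrows\mathbb{R}^m$ and $(x,y)\in\mathrm{gph}\,F$, the limiting coderivative is $D^*F(x,y)(v)=\{u:(u,-v)\in N_{\mathrm{gph}\,F}(x,y)\}$, and the directional limiting coderivative in the direction $(u,v)$ is $D^*F((x,y);(u,v))(v^* )=\{u^*:(u^*,-v^* )\in N_{\mathrm{gph}\,F}((x,y);(u,v))\}$. $A^*$ is the transpose of $A$; $\|\cdot\|_2$ and $\|\cdot\|_1$ are the Euclidean and sum norms. For $\psi\colon\mathbb{R}^n\to(-\infty,\infty]$ the limiting subdifferential at $x\in\mathrm{dom}\,\psi$ is $\partial\psi(x)=\{v:(v,-1)\in N_{\mathrm{epi}\,\psi}(x,\psi(x))\}$, and $\partial^2\psi(x,v)(u)=(D^*\partial\psi)(x,v)(u)$ for $v\in\partial\psi(x)$. $\psi$ is prox-regular at $\bar x\in\mathrm{dom}\,\psi$ for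 $\bar v\in\partial\psi(\bar x)$ if it is lower semicontinuous around $\bar x$ and there are $r,\epsilon>0$ such that for all $x,u\in\mathbb{B}_\epsilon(\bar x)$ with $|\psi(u)-\psi(\bar x)|<\epsilon$ one has $\psi(x)\ge\psi(u)+\langle v,x-u\rangle-\frac r2\|x-u\|^2$ whenever $v\in\partial\psi(u)\cap\mathbb{B}_\epsilon(\bar v)$. It is subdifferentially continuous at $\bar x$ for $\bar v$ if $(x_k,v_k)\to(\bar x,\bar v)$ with $v_k\in\partial\psi(x_k)$ implies $\psi(x_k)\to\psi(\bar x)$. Continuously prox-regular means both. Prox-bounded means bounded from below by a quadratic function. $\mathrm{Prox}_{\gamma g}(x)=\mathrm{argmin}_{y}\{g(y)+\frac1{2\gamma}\|y-x\|^2\}$. $F$ is metrically regular around $(\bar x,\bar y)\in\mathrm{gph}\,F$ if there are $\kappa>0$ and neighborhoods $U$ of $\bar x$, $V$ of $\bar y$ with $\mathrm{dist}(x;F^{-1}(y))\le\kappa\,\mathrm{dist}(y;F(x))$ for all $(x,y)\in U\times V$. $F$ is semismooth$^*$ at $(\bar x,\bar y)\in\mathrm{gph}\,F$ if for every $(u,v)$ one has $\langle u^*,u\rangle=\langle v^*,v\rangle$ for all $(v^*,u^* )\in\mathrm{gph}\,D^*F((\bar x,\bar y);(u,v))$. "Well-defined" means that at each non-terminal iterate a suitable $d^k$ (which may be chosen arbitrarily) exists. $Q$-superlinear convergence means $x^k\to\bar x$ and $\|x^{k+1}-\bar x\|/\|x^k-\bar x\|\to0$; if the algorithm stops at some $x^k$,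 it is understood as $x^k=\bar x$. Explicit data used by the algorithm: for $\gamma\in(0,\frac1{2\mu_2})$, $(\mathrm{Prox}_{\gamma g}(x))_i$ equals $\frac{x_i-\gamma\mu_1}{1-2\gamma\mu_2}$ if $x_i>\mu_1\gamma$, $0$ if $|x_i|\le\mu_1\gamma$, $\frac{x_i+\gamma\mu_1}{1-2\gamma\mu_2}$ if $x_i<-\mu_1\gamma$; $\partial\varphi(x)=A^*(Ax-b)+\mu_1F(x)-2\mu_2x$ with $F(x)=\{v:v_j=\mathrm{sgn}(x_j)\text{ if }x_j\ne0,\ v_j\in[-1,1]\text{ if }x_j=0\}$; and $\partial^2g(x,y)(v)=\{w:(\frac1{\mu_1}(w_i+2\mu_2v_i),-v_i)\in G(x_i,\frac1{\mu_1}(y_i+2\mu_2x_i)),\ i=1,\dots,n\}$, where $G(t,p)$ is $\{0\}\times\mathbb{R}$ if $t\ne0$, $p\in\{-1,1\}$; $\mathbb{R}\times\{0\}$ if $t=0$, $p\in(-1,1)$; $(\mathbb{R}_+\times\mathbb{R}_-)\cup(\{0\}\times\mathbb{R})\cup(\mathbb{R}\times\{0\})$ if $t=0$, $p=-1$; $(\mathbb{R}_-\times\mathbb{R}_+)\cup(\{0\}\times\mathbb{R})\cup(\mathbb{R}\times\{0\})$ if $t=0$, $p=1$; $\emptyset$ otherwise. *)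

theory Defs
  imports "HOL-Analysis.Analysis"
begin

section \<open>Normal cones\<close>

text \<open>At an isolated point of \<open>\<Omega>\<close> the filter is trivial and the upper limit is \<open>-\<infinity>\<close>, so
  every vector is normal. Outside of \<open>\<Omega>\<close> all normal cones are empty.\<close>

definition regular_normal_cone :: "'a::euclidean_space set \<Rightarrow> 'a \<Rightarrow> 'a set" where
  "regular_normal_cone \<Omega> z0 =
    {v. z0 \<in> \<Omega> \<and>
        Limsup (at z0 within \<Omega>) (\<lambda>z. ereal (inner v (z - z0) / norm (z - z0))) \<le> 0}"

definition limiting_normal_cone :: "'a::euclidean_space set \<Rightarrow> 'a \<Rightarrow> 'a set" where
  "limiting_normal_cone \<Omega> z0 =
    {v. z0 \<in> \<Omega> \<and>
        (\<exists>z w. z \<longlonglongrightarrow> z0 \<and> (\<forall>k. z k \<in> \<Omega>) \<and> w \<longlonglongrightarrow> v \<and>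
               (\<forall>k::nat. w k \<in> regular_normal_cone \<Omega> (z k)))}"

definition directional_normal_cone :: "'a::euclidean_space set \<Rightarrow> 'a \<Rightarrow> 'a \<Rightarrow> 'a set" where
  "directional_normal_cone \<Omega> z0 d =
    {v. z0 \<in> \<Omega> \<and>
        (\<exists>(t::nat \<Rightarrow> real) e w. (\<forall>k. t k > 0) \<and> t \<longlonglongrightarrow> 0 \<and> e \<longlonglongrightarrow> d \<and> w \<longlonglongrightarrow> v \<and>
               (\<forall>k. w k \<in> regular_normal_cone \<Omega> (z0 + t k *\<^sub>R e k)))}"


section \<open>Set-valued mappings\<close>

definition gph :: "('a \<Rightarrow> 'b set) \<Rightarrow> ('a \<times> 'b) set" where
  "gph F = {(x, y). y \<in> F x}"

definition coderivative ::
  "('a::euclidean_space \<Rightarrow> 'b::euclidean_space set) \<Rightarrow> 'a \<Rightarrow> 'b \<Rightarrow> 'b \<Rightarrow> 'a set" where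
  "coderivative F x y v = {u. (u, - v) \<in> limiting_normal_cone (gph F) (x, y)}"

definition directional_coderivative ::
  "('a::euclidean_space \<Rightarrow> 'b::euclidean_space set) \<Rightarrow> 'a \<times> 'b \<Rightarrow> 'a \<times> 'b \<Rightarrow> 'b \<Rightarrow> 'a set" where
  "directional_coderivative F z d v =
    {u. (u, - v) \<in> directional_normal_cone (gph F) z d}"

text \<open>Extended-real-valued, since the distance to the empty set has to be \<open>\<infinity>\<close>
  (\<open>infdist\<close> and \<open>setdist\<close> would give \<open>0\<close>).\<close>

definition dist_to_set :: "'a::metric_space \<Rightarrow> 'a set \<Rightarrow> ereal" where
  "dist_to_set x S = (INF a\<in>S. ereal (dist x a))"

definition metrically_regular_around ::
  "('a::euclidean_space \<Rightarrow> 'b::euclidean_space set) \<Rightarrow> 'a \<Rightarrow> 'b \<Rightarrow> bool" where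
  "metrically_regular_around F x0 y0 \<longleftrightarrow>
    (x0, y0) \<in> gph F \<and>
    (\<exists>\<kappa>>0. \<exists>U V. open U \<and> x0 \<in> U \<and> open V \<and> y0 \<in> V \<and>
       (\<forall>x\<in>U. \<forall>y\<in>V. dist_to_set x {x'. y \<in> F x'} \<le> ereal \<kappa> * dist_to_set y (F x)))"

definition semismooth_star_at ::
  "('a::euclidean_space \<Rightarrow> 'b::euclidean_space set) \<Rightarrow> 'a \<Rightarrow> 'b \<Rightarrow> bool" where
  "semismooth_star_at F x0 y0 \<longleftrightarrow>
    (x0, y0) \<in> gph F \<and>
    (\<forall>u v. \<forall>(v', u') \<in> gph (directional_coderivative F (x0, y0) (u, v)).
       inner u' u = inner v' v)"


section \<open>Extended-real-valued functions\<close>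

definition effective_domain :: "('a \<Rightarrow> ereal) \<Rightarrow> 'a set" where
  "effective_domain \<psi> = {x. \<bar>\<psi> x\<bar> \<noteq> \<infinity>}"

definition epi :: "('a \<Rightarrow> ereal) \<Rightarrow> ('a \<times> real) set" where
  "epi \<psi> = {(x, \<alpha>). \<psi> x \<le> ereal \<alpha>}"

definition limiting_subdifferential :: "('a::euclidean_space \<Rightarrow> ereal) \<Rightarrow> 'a \<Rightarrow> 'a set" where
  "limiting_subdifferential \<psi> x =
    {v. x \<in> effective_domain \<psi> \<and>
        (v, -1) \<in> limiting_normal_cone (epi \<psi>) (x, real_of_ereal (\<psi> x))}"

definition second_subdifferential ::
  "('a::euclidean_space \<Rightarrow> ereal) \<Rightarrow> 'a \<Rightarrow> 'a \<Rightarrow> 'a \<Rightarrow> 'a set" where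
  "second_subdifferential \<psi> x v u = coderivative (limiting_subdifferential \<psi>) x v u"

definition lsc_around :: "('a::euclidean_space \<Rightarrow> ereal) \<Rightarrow> 'a \<Rightarrow> bool" where
  "lsc_around \<psi> x0 \<longleftrightarrow>
    (\<exists>U. open U \<and> x0 \<in> U \<and> (\<forall>x\<in>U. \<psi> x \<le> Liminf (at x) \<psi>))"

definition prox_regular_at ::
  "('a::euclidean_space \<Rightarrow> ereal) \<Rightarrow> 'a \<Rightarrow> 'a \<Rightarrow> bool" where
  "prox_regular_at \<psi> x0 v0 \<longleftrightarrow>
    x0 \<in> effective_domain \<psi> \<and> v0 \<in> limiting_subdifferential \<psi> x0 \<and> lsc_around \<psi> x0 \<and>
    (\<exists>r>0. \<exists>\<epsilon>>0. \<forall>x\<in>cball x0 \<epsilon>. \<forall>u\<in>cball x0 \<epsilon>. \<bar>\<psi> u - \<psi> x0\<bar> < ereal \<epsilon> \<longrightarrow>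
       (\<forall>v \<in> limiting_subdifferential \<psi> u \<inter> cball v0 \<epsilon>.
          \<psi> x \<ge> \<psi> u + ereal (inner v (x - u) - r / 2 * (norm (x - u))\<^sup>2)))"

definition subdifferentially_continuous_at ::
  "('a::euclidean_space \<Rightarrow> ereal) \<Rightarrow> 'a \<Rightarrow> 'a \<Rightarrow> bool" where
  "subdifferentially_continuous_at \<psi> x0 v0 \<longleftrightarrow>
    x0 \<in> effective_domain \<psi> \<and> v0 \<in> limiting_subdifferential \<psi> x0 \<and>
    (\<forall>x v. x \<longlonglongrightarrow> x0 \<longrightarrow> v \<longlonglongrightarrow> v0 \<longrightarrow>
       (\<forall>k::nat. v k \<in> limiting_subdifferential \<psi> (x k)) \<longrightarrow>
       (\<lambda>k. \<psi> (x k)) \<longlonglongrightarrow> \<psi> x0)"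

definition continuously_prox_regular_at ::
  "('a::euclidean_space \<Rightarrow> ereal) \<Rightarrow> 'a \<Rightarrow> 'a \<Rightarrow> bool" where
  "continuously_prox_regular_at \<psi> x0 v0 \<longleftrightarrow>
    prox_regular_at \<psi> x0 v0 \<and> subdifferentially_continuous_at \<psi> x0 v0"

definition prox_bounded :: "('a::euclidean_space \<Rightarrow> ereal) \<Rightarrow> bool" where
  "prox_bounded \<psi> \<longleftrightarrow>
    (\<exists>Q c \<alpha>. linear Q \<and> (\<forall>x. \<psi> x \<ge> ereal (inner (Q x) x + inner c x + \<alpha>)))"

definition Prox :: "real \<Rightarrow> ('a::euclidean_space \<Rightarrow> ereal) \<Rightarrow> 'a \<Rightarrow> 'a set" where
  "Prox \<gamma> \<psi> x =
    {y. is_arg_min (\<lambda>y. \<psi> y + ereal (1 / (2 * \<gamma>) * (norm (y - x))\<^sup>2)) (\<lambda>_. True) y}"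


section \<open>The regularized least squares problem\<close>

definition l1_norm :: "real ^ 'n \<Rightarrow> real" where
  "l1_norm x = (\<Sum>i\<in>UNIV. \<bar>x $ i\<bar>)"

definition g_fun :: "real \<Rightarrow> real \<Rightarrow> real ^ 'n \<Rightarrow> ereal" where
  "g_fun \<mu>1 \<mu>2 x = ereal (\<mu>1 * l1_norm x - \<mu>2 * (norm x)\<^sup>2)"

definition phi_fun ::
  "real ^ 'n ^ 'm \<Rightarrow> real ^ 'm \<Rightarrow> real \<Rightarrow> real \<Rightarrow> real ^ 'n \<Rightarrow> ereal" where
  "phi_fun A b \<mu>1 \<mu>2 x =
    ereal (1 / 2 * (norm (A *v x - b))\<^sup>2 + \<mu>1 * l1_norm x - \<mu>2 * (norm x)\<^sup>2)"


section \<open>The algorithm\<close>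

text \<open>One pass through the loop, from a non-terminal iterate \<open>x\<close> to a possible next iterate
  \<open>x'\<close>. The assignment \<open>v := Prox \<gamma> g u\<close> is read as: the set of minimizers is exactly \<open>{v}\<close>.\<close>

definition newton_step ::
  "real ^ 'n ^ 'm \<Rightarrow> real ^ 'm \<Rightarrow> real \<Rightarrow> real \<Rightarrow> real \<Rightarrow> real ^ 'n \<Rightarrow> real ^ 'n \<Rightarrow> bool" where
  "newton_step A b \<mu>1 \<mu>2 \<gamma> x x' \<longleftrightarrow>
    0 \<notin> limiting_subdifferential (phi_fun A b \<mu>1 \<mu>2) x \<and>
    (\<exists>u v d.
       u = x - \<gamma> *\<^sub>R (transpose A *v (A *v x) - transpose A *v b) \<and>
       Prox \<gamma> (g_fun \<mu>1 \<mu>2) u = {v} \<and>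
       - ((1 / \<gamma>) *\<^sub>R (x - v)) - transpose A *v (A *v d)
         \<in> second_subdifferential (g_fun \<mu>1 \<mu>2) v ((1 / \<gamma>) *\<^sub>R (u - v)) (x - v + d) \<and>
       x' = x + d)"

text \<open>The choice of \<open>d\<close> in each pass is arbitrary, so a step is a relation, and the points
  related to \<open>x0\<close> by its reflexive transitive closure are the iterates of all runs from \<open>x0\<close>.\<close>

definition newton_well_defined ::
  "real ^ 'n ^ 'm \<Rightarrow> real ^ 'm \<Rightarrow> real \<Rightarrow> real \<Rightarrow> real \<Rightarrow> real ^ 'n \<Rightarrow> bool" where
  "newton_well_defined A b \<mu>1 \<mu>2 \<gamma> x0 \<longleftrightarrow>
    (\<forall>x. (newton_step A b \<mu>1 \<mu>2 \<gamma>)\<^sup>*\<^sup>* x0 x \<longrightarrow>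
         0 \<notin> limiting_subdifferential (phi_fun A b \<mu>1 \<mu>2) x \<longrightarrow>
         (\<exists>x'. newton_step A b \<mu>1 \<mu>2 \<gamma> x x'))"

definition Q_superlinearly_converges ::
  "(nat \<Rightarrow> 'a::real_normed_vector) \<Rightarrow> 'a \<Rightarrow> bool" where
  "Q_superlinearly_converges X l \<longleftrightarrow>
    X \<longlonglongrightarrow> l \<and> (\<lambda>k. norm (X (Suc k) - l) / norm (X k - l)) \<longlonglongrightarrow> 0"

text \<open>Runs that stop have to stop at \<open>xbar\<close>; runs that do not stop have to converge.\<close>

definition newton_Q_superlinear ::
  "real ^ 'n ^ 'm \<Rightarrow> real ^ 'm \<Rightarrow> real \<Rightarrow> real \<Rightarrow> real \<Rightarrow> real ^ 'n \<Rightarrow> real ^ 'n \<Rightarrow> bool" where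
  "newton_Q_superlinear A b \<mu>1 \<mu>2 \<gamma> xbar x0 \<longleftrightarrow>
    (\<forall>x. (newton_step A b \<mu>1 \<mu>2 \<gamma>)\<^sup>*\<^sup>* x0 x \<longrightarrow>
         0 \<in> limiting_subdifferential (phi_fun A b \<mu>1 \<mu>2) x \<longrightarrow> x = xbar) \<and>
    (\<forall>X. X 0 = x0 \<longrightarrow> (\<forall>k. newton_step A b \<mu>1 \<mu>2 \<gamma> (X k) (X (Suc k))) \<longrightarrow>
         Q_superlinearly_converges X xbar)"

end

theory Submission
  imports Defs
begin

text \<open>The graph \<open>\<Gamma>\<close> of \<open>\<partial>\<phi>\<close> is polyhedral, and up to a linear change of variables it is a product of planar
curves, one for each coordinate: \<open>v \<in> \<partial>\<phi>(x)\<close> means that \<open>q = (v - \<nabla>h(x)) / \<mu>1\<close> is coordinatewise a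
subgradient of the absolute value at \<open>x\<close>, where \<open>h\<close> is the quadratic part of \<open>\<phi>\<close>
(\<open>limiting_subdifferential_phi_fun\<close>). Since the Hessian of \<open>h\<close> is symmetric, \<open>\<Gamma>\<close> is also Lagrangian: the
rotation \<open>R (a, c) = (- c, a)\<close> maps the directions of each affine piece of \<open>\<Gamma>\<close> to normal directions of this piece.

Take a point \<open>p = (x, v)\<close> of \<open>\<Gamma>\<close> near \<open>p0 = (xbar, 0)\<close>. In each coordinate either \<open>p\<close> and \<open>p0\<close> agree, or \<open>p\<close>
lies in the relative interior of a segment of the curve that ends at \<open>p0\<close> or passes through it. Hence
all of \<open>\<Gamma>\<close> near \<open>p\<close> is orthogonal, as seen from \<open>p\<close>, to \<open>R (p0 - p) = (v, xbar - x)\<close>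
(\<open>gph_locally_rotated_orthogonal\<close>), so adding multiples of this vector to a normal at \<open>p\<close> gives a normal
again. All claims about second-order subdifferentials follow from this.

\<^item> Adding \<open>- R (p0 - p)\<close> to the zero normal gives \<open>- v \<in> \<partial>\<^sup>2\<phi>(x, v)(xbar - x)\<close>: the direction
  \<open>xbar - x\<close> solves the generalized Newton equation.

\<^item> If \<open>d\<close> solves it as well, then adding \<open>R (p0 - p)\<close> to the normal \<open>(- v, - d)\<close> gives
  \<open>0 \<in> \<partial>\<^sup>2\<phi>(x, v)(d - (xbar - x))\<close>. By metric regularity the kernel of the coderivative is trivial
  (\<open>metrically_regular_coderivative_kernel\<close>), so \<open>d = xbar - x\<close>. The same argument with \<open>v = 0\<close> shows that
  \<open>xbar\<close> is the only stationary point nearby.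

\<^item> A step of the algorithm moves from the current iterate to a point of \<open>\<Gamma>\<close> by means of the proximal mapping, and
  then solves the Newton equation there. That point is close to \<open>p0\<close>, because the proximal mapping is
  Lipschitz, so every admissible step from a point near \<open>xbar\<close> ends exactly at \<open>xbar\<close>
  (\<open>eventually_newton_step_iff\<close>).

For the semismooth* property one uses instead that \<open>\<Gamma>\<close> contains a line segment in the direction \<open>p - p0\<close> with
\<open>p\<close> in its interior, so that normals at \<open>p\<close> are orthogonal to \<open>p - p0\<close>. The properties of \<open>g\<close> itself come
from the global subgradient inequality \<open>phi_real_subgradient_ineq\<close>; \<open>g\<close> is the case \<open>A = 0\<close>, \<open>b = 0\<close> of \<open>\<phi>\<close>,
so one computation serves both functions.\<close>


section \<open>Calculus of normal cones\<close>

lemma regular_normal_cone_iff: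
  "v \<in> regular_normal_cone \<Omega> z0 \<longleftrightarrow>
     z0 \<in> \<Omega> \<and> (\<forall>e>0. \<forall>\<^sub>F z in nhds z0. z \<in> \<Omega> \<longrightarrow> inner v (z - z0) \<le> e * norm (z - z0))"
proof -
  let ?f = "\<lambda>z. inner v (z - z0) / norm (z - z0)"
  have "Limsup (at z0 within \<Omega>) (\<lambda>z. ereal (?f z)) \<le> 0 \<longleftrightarrow>
      (\<forall>y>0. \<forall>\<^sub>F z in at z0 within \<Omega>. ereal (?f z) < y)"
    by (rule Limsup_le_iff)
  also have "\<dots> \<longleftrightarrow> (\<forall>e>0. \<forall>\<^sub>F z in at z0 within \<Omega>. ?f z \<le> e)"
  proof (intro iffI allI impI)
    fix e :: real assume *: "\<forall>y>0. \<forall>\<^sub>F z in at z0 within \<Omega>. ereal (?f z) < y" "e > 0"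
    have "\<forall>\<^sub>F z in at z0 within \<Omega>. ereal (?f z) < ereal e"
      using *(1)[rule_format, of "ereal e"] *(2) by simp
    then show "\<forall>\<^sub>F z in at z0 within \<Omega>. ?f z \<le> e"
      by (rule eventually_mono) simp
  next
    fix y :: ereal assume *: "\<forall>e>0. \<forall>\<^sub>F z in at z0 within \<Omega>. ?f z \<le> e" "y > 0"
    obtain e where e: "0 < ereal e" "ereal e < y"
      using ereal_dense2[OF *(2)] by blast
    have "\<forall>\<^sub>F z in at z0 within \<Omega>. ?f z \<le> e"
      using * e by simp
    then show "\<forall>\<^sub>F z in at z0 within \<Omega>. ereal (?f z) < y"
      by (rule eventually_mono) (use e(2) in \<open>meson ereal_less_eq(3) le_less_trans\<close>)
  qed
  also have "\<dots> \<longleftrightarrow>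
      (\<forall>e>0. \<forall>\<^sub>F z in nhds z0. z \<in> \<Omega> \<longrightarrow> inner v (z - z0) \<le> e * norm (z - z0))"
  proof -
    have "(z \<noteq> z0 \<longrightarrow> z \<in> \<Omega> \<longrightarrow> ?f z \<le> e) \<longleftrightarrow>
        (z \<in> \<Omega> \<longrightarrow> inner v (z - z0) \<le> e * norm (z - z0))" for z e
      by (cases "z = z0") (auto simp: pos_divide_le_eq)
    then show ?thesis
      by (simp only: eventually_at_filter)
  qed
  finally show ?thesis
    by (simp add: regular_normal_cone_def)
qed

lemma regular_normal_cone_add_orthogonal:
  assumes "n \<in> regular_normal_cone \<Omega> p" "\<forall>\<^sub>F z in nhds p. z \<in> \<Omega> \<longrightarrow> inner m (z - p) = 0"
  shows "n + m \<in> regular_normal_cone \<Omega> p"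
  unfolding regular_normal_cone_iff
proof (intro conjI allI impI)
  show "p \<in> \<Omega>"
    using assms(1) by (simp add: regular_normal_cone_iff)
  fix e :: real assume "e > 0"
  then have "\<forall>\<^sub>F z in nhds p. z \<in> \<Omega> \<longrightarrow> inner n (z - p) \<le> e * norm (z - p)"
    using assms(1) by (simp add: regular_normal_cone_iff)
  with assms(2) show "\<forall>\<^sub>F z in nhds p. z \<in> \<Omega> \<longrightarrow> inner (n + m) (z - p) \<le> e * norm (z - p)"
    by eventually_elim (simp add: inner_add_left)
qed

text \<open>A vector that is orthogonal to \<open>\<Omega>\<close> as seen from \<open>p\<close> is orthogonal to all differences of points of \<open>\<Omega>\<close>
near \<open>p\<close>, hence also to \<open>\<Omega>\<close> as seen from the nearby points that carry the approximating regular normals.\<close>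

lemma limiting_normal_cone_add_orthogonal:
  assumes n: "n \<in> limiting_normal_cone \<Omega> p"
    and m: "\<forall>\<^sub>F z in nhds p. z \<in> \<Omega> \<longrightarrow> inner m (z - p) = 0"
  shows "n + m \<in> limiting_normal_cone \<Omega> p"
proof -
  obtain z w where z: "z \<longlonglongrightarrow> p" "\<And>k. z k \<in> \<Omega>" "w \<longlonglongrightarrow> n" and p: "p \<in> \<Omega>"
    and w: "\<And>k::nat. w k \<in> regular_normal_cone \<Omega> (z k)"
    using n unfolding limiting_normal_cone_def by auto
  obtain W where W: "open W" "p \<in> W" "\<And>z. z \<in> W \<Longrightarrow> z \<in> \<Omega> \<Longrightarrow> inner m (z - p) = 0"
    using m unfolding eventually_nhds by auto
  have "\<forall>\<^sub>F k in sequentially. z k \<in> W"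
    using topological_tendstoD[OF z(1) W(1,2)] .
  then obtain N where N: "\<And>k. z (k + N) \<in> W"
    unfolding eventually_sequentially by (meson le_add2)
  have "w (k + N) + m \<in> regular_normal_cone \<Omega> (z (k + N))" for k
  proof (rule regular_normal_cone_add_orthogonal[OF w])
    have "\<forall>\<^sub>F y in nhds (z (k + N)). y \<in> W"
      using eventually_nhds_in_open[OF W(1) N] .
    then show "\<forall>\<^sub>F y in nhds (z (k + N)). y \<in> \<Omega> \<longrightarrow> inner m (y - z (k + N)) = 0"
    proof (rule eventually_mono, intro impI)
      fix y assume "y \<in> W" "y \<in> \<Omega>"
      then have "inner m (y - p) = 0" "inner m (z (k + N) - p) = 0"
        using W(3) N z(2) by auto
      then show "inner m (y - z (k + N)) = 0"
        by (simp add: inner_diff_right)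
    qed
  qed
  moreover have "(\<lambda>k. z (k + N)) \<longlonglongrightarrow> p" "(\<lambda>k. w (k + N) + m) \<longlonglongrightarrow> n + m"
    using z(1,3) by (auto intro!: tendsto_intros LIMSEQ_ignore_initial_segment)
  ultimately show ?thesis
    using p z(2) unfolding limiting_normal_cone_def
    by (intro CollectI conjI exI[of _ "\<lambda>k. z (k + N)"] exI[of _ "\<lambda>k. w (k + N) + m"]) auto
qed

lemma zero_in_limiting_normal_cone:
  assumes "p \<in> \<Omega>"
  shows "0 \<in> limiting_normal_cone \<Omega> p"
  using assms unfolding limiting_normal_cone_def
  by (intro CollectI conjI exI[of _ "\<lambda>_. p"] exI[of _ "\<lambda>_. 0"]) (auto simp: regular_normal_cone_iff)

lemma regular_normal_orthogonal_to_line: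
  assumes n: "n \<in> regular_normal_cone \<Omega> p" and line: "\<forall>\<^sub>F t in nhds (0::real). p + t *\<^sub>R w \<in> \<Omega>"
  shows "inner n w = 0"
proof -
  have "\<bar>inner n w\<bar> \<le> e * norm w" if e: "e > 0" for e
  proof -
    have ev: "\<forall>\<^sub>F z in nhds p. z \<in> \<Omega> \<longrightarrow> inner n (z - p) \<le> e * norm (z - p)"
      using n e by (simp add: regular_normal_cone_iff)
    have "((\<lambda>t::real. p + t *\<^sub>R w) \<longlongrightarrow> p + 0 *\<^sub>R w) (nhds 0)"
      by (intro tendsto_intros filterlim_ident)
    then have "\<forall>\<^sub>F t in nhds (0::real). p + t *\<^sub>R w \<in> \<Omega> \<longrightarrow> inner n (t *\<^sub>R w) \<le> e * norm (t *\<^sub>R w)"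
      using ev unfolding filterlim_iff by fastforce
    with line have "\<forall>\<^sub>F t in nhds (0::real). inner n (t *\<^sub>R w) \<le> e * norm (t *\<^sub>R w)"
      by eventually_elim simp
    then obtain d where d: "d > 0" "\<And>t. \<bar>t\<bar> < d \<Longrightarrow> t * inner n w \<le> e * (\<bar>t\<bar> * norm w)"
      unfolding eventually_nhds_metric by (auto simp: dist_real_def)
    have "d/2 * inner n w \<le> d/2 * (e * norm w)" "d/2 * (- inner n w) \<le> d/2 * (e * norm w)"
      using d(2)[of "d/2"] d(2)[of "-(d/2)"] d(1) by (simp_all add: algebra_simps)
    then have "inner n w \<le> e * norm w" "- inner n w \<le> e * norm w"
      using d(1) by (simp_all only: mult_le_cancel_left_pos half_gt_zero)
    then show ?thesis
      by (simp add: abs_le_iff)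
  qed
  moreover have "e / (norm w + 1) * norm w \<le> e" if "e > 0" for e
    using that by (simp add: field_simps add_pos_nonneg)
  ultimately have "\<bar>inner n w\<bar> \<le> 0 + e" if "e > 0" for e
    using that add_pos_nonneg[OF zero_less_one norm_ge_zero[of w]]
    by (metis add.commute add.left_neutral divide_pos_pos order_trans)
  then have "\<bar>inner n w\<bar> \<le> 0"
    by (rule field_le_epsilon)
  then show ?thesis by simp
qed

section \<open>Metric regularity and the kernel of the coderivative\<close>

text \<open>Moving from \<open>y\<close> to \<open>y - t z\<close>, metric regularity supplies a preimage \<open>x'\<close> within \<open>2 \<kappa> t |z|\<close> of \<open>x\<close>. Testing the
normal \<open>(a, - z)\<close> with this graph point compares \<open>t |z|\<^sup>2\<close> with \<open>|a| |x' - x|\<close> up to \<open>o(t)\<close>. The factor 2 leaves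
room for the infimum in the distance not being attained.\<close>

lemma regular_coderivative_bound:
  assumes k: "\<kappa> > 0" and V: "open V"
    and reg: "\<And>x' y'. x' \<in> U \<Longrightarrow> y' \<in> V \<Longrightarrow>
      dist_to_set x' {x''. y' \<in> F x''} \<le> ereal \<kappa> * dist_to_set y' (F x')"
    and xy: "x \<in> U" "y \<in> V" and n: "(a, - z) \<in> regular_normal_cone (gph F) (x, y)"
  shows "norm z \<le> 2 * \<kappa> * norm a"
proof (cases "z = 0")
  case False
  have yF: "y \<in> F x"
    using n by (simp add: regular_normal_cone_iff gph_def)
  have bound: "norm z \<le> 2 * \<kappa> * norm a + e * (2 * \<kappa> + 1)" if e: "e > 0" for e
  proof -
    have "\<forall>\<^sub>F w in nhds (x, y). w \<in> gph F \<longrightarrow>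
        inner (a, - z) (w - (x, y)) \<le> e * norm (w - (x, y))"
      using n e by (simp add: regular_normal_cone_iff)
    then obtain r where r: "r > 0" "\<And>w. dist w (x, y) < r \<Longrightarrow> w \<in> gph F \<Longrightarrow>
        inner (a, - z) (w - (x, y)) \<le> e * norm (w - (x, y))"
      unfolding eventually_nhds_metric by blast
    obtain \<rho> where \<rho>: "\<rho> > 0" "ball y \<rho> \<subseteq> V"
      using V xy(2) open_contains_ball by blast
    define c where "c = (2 * \<kappa> + 1) * norm z"
    have c: "c > 0" using k False by (simp add: c_def)
    \<comment> \<open>so small that the perturbed point stays in \<open>V\<close> and in the ball where the normal inequality holds\<close>
    define t where "t = min (\<rho> / (2 * norm z)) (r / (2 * c))"
    have t: "t > 0" using \<rho>(1) r(1) c False by (simp add: t_def)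
    have "t \<le> \<rho> / (2 * norm z)" "t \<le> r / (2 * c)"
      by (simp_all add: t_def)
    then have "t * norm z \<le> \<rho> / 2" "t * c \<le> r / 2"
      using c False by (simp_all add: pos_le_divide_eq algebra_simps)
    then have tz: "t * norm z < \<rho>" "t * c < r"
      using \<rho>(1) r(1) by linarith+
    define y' where "y' = y - t *\<^sub>R z"
    have "dist y y' < \<rho>"
      using tz t by (simp add: y'_def dist_norm)
    then have y': "y' \<in> V"
      using \<rho>(2) by auto
    have "dist_to_set y' (F x) \<le> ereal (t * norm z)"
      unfolding dist_to_set_def by (rule INF_lower2[OF yF]) (use t in \<open>simp add: y'_def dist_norm\<close>)
    then have "ereal \<kappa> * dist_to_set y' (F x) \<le> ereal \<kappa> * ereal (t * norm z)"
      using k by (intro ereal_mult_left_mono) auto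
    then have "dist_to_set x {x''. y' \<in> F x''} \<le> ereal (\<kappa> * (t * norm z))"
      using order_trans[OF reg[OF xy(1) y']] by simp
    also have "\<dots> < ereal (2 * \<kappa> * (t * norm z))"
      using k t False by simp
    finally obtain x' where x': "y' \<in> F x'" "dist x x' < 2 * \<kappa> * (t * norm z)"
      unfolding dist_to_set_def INF_less_iff by auto
    have "norm ((x', y') - (x, y)) \<le> norm (x' - x) + norm (y' - y)"
      by (simp add: norm_Pair_le)
    also have "\<dots> \<le> 2 * \<kappa> * (t * norm z) + t * norm z"
      using x'(2) t by (simp add: y'_def dist_norm norm_minus_commute)
    also have "\<dots> = t * c"
      by (simp add: c_def algebra_simps)
    finally have nrm: "norm ((x', y') - (x, y)) \<le> t * c" .
    have "inner (a, - z) ((x', y') - (x, y)) \<le> e * norm ((x', y') - (x, y))"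
      using r(2)[of "(x', y')"] nrm tz(2) x'(1) by (simp add: dist_norm gph_def)
    also have "\<dots> \<le> e * (t * c)"
      using e nrm by (simp add: mult_left_mono)
    finally have "inner a (x' - x) + t * (norm z)\<^sup>2 \<le> e * (t * c)"
      by (simp add: y'_def power2_norm_eq_inner)
    moreover have "- inner a (x' - x) \<le> norm a * (2 * \<kappa> * (t * norm z))"
    proof -
      have "- inner a (x' - x) \<le> norm a * norm (x' - x)"
        using Cauchy_Schwarz_ineq2[of a "x' - x"] by linarith
      also have "\<dots> \<le> norm a * (2 * \<kappa> * (t * norm z))"
        using x'(2) by (intro mult_left_mono) (auto simp: dist_norm norm_minus_commute)
      finally show ?thesis .
    qed
    ultimately have "(t * norm z) * norm z \<le> (t * norm z) * (2 * \<kappa> * norm a + e * (2 * \<kappa> + 1))"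
      by (simp add: c_def power2_eq_square algebra_simps)
    then show ?thesis
      using t False by (simp add: mult_le_cancel_left_pos)
  qed
  have "norm z \<le> 2 * \<kappa> * norm a + e" if "e > 0" for e
    using bound[of "e / (2 * \<kappa> + 1)"] that k by (simp add: divide_pos_pos)
  then show ?thesis
    by (rule field_le_epsilon)
qed (use k in simp)

text \<open>The easy half of the Mordukhovich criterion. The uniform bound for regular normals passes to limits, and it holds
on a whole neighbourhood since metric regularity is assumed on one.\<close>

lemma metrically_regular_coderivative_kernel:
  assumes "metrically_regular_around F x0 y0"
  shows "\<forall>\<^sub>F p in nhds (x0, y0). \<forall>z. 0 \<in> coderivative F (fst p) (snd p) z \<longrightarrow> z = 0"
proof -
  obtain \<kappa> U V where k: "\<kappa> > 0" and U: "open U" "x0 \<in> U" and V: "open V" "y0 \<in> V"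
    and reg: "\<And>x y. x \<in> U \<Longrightarrow> y \<in> V \<Longrightarrow>
      dist_to_set x {x'. y \<in> F x'} \<le> ereal \<kappa> * dist_to_set y (F x)"
    using assms unfolding metrically_regular_around_def by blast
  have "\<forall>\<^sub>F p in nhds (x0, y0). p \<in> U \<times> V"
    using U V by (intro eventually_nhds_in_open open_Times) auto
  then show ?thesis
  proof (rule eventually_mono, safe)
    fix x y z assume xy: "x \<in> U" "y \<in> V"
      and "0 \<in> coderivative F (fst (x, y)) (snd (x, y)) z"
    then have "(0, - z) \<in> limiting_normal_cone (gph F) (x, y)"
      by (simp add: coderivative_def)
    then obtain p w where p: "p \<longlonglongrightarrow> (x, y)" and w: "w \<longlonglongrightarrow> (0, - z)"
      and n: "\<And>k::nat. w k \<in> regular_normal_cone (gph F) (p k)"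
      unfolding limiting_normal_cone_def by auto
    have "\<forall>\<^sub>F k in sequentially. p k \<in> U \<times> V"
      using p U V xy by (intro topological_tendstoD) (auto intro: open_Times)
    then have ev: "\<forall>\<^sub>F k in sequentially. norm (snd (w k)) \<le> 2 * \<kappa> * norm (fst (w k))"
    proof (rule eventually_mono)
      fix k assume "p k \<in> U \<times> V"
      then show "norm (snd (w k)) \<le> 2 * \<kappa> * norm (fst (w k))"
        using regular_coderivative_bound[OF k V(1) reg, where x = "fst (p k)" and y = "snd (p k)"
          and a = "fst (w k)" and z = "- snd (w k)"] n[of k]
        by (simp add: mem_Times_iff)
    qed
    have "(\<lambda>k. norm (snd (w k))) \<longlonglongrightarrow> norm (snd (0::'a, - z))"
      "(\<lambda>k. 2 * \<kappa> * norm (fst (w k))) \<longlonglongrightarrow> 2 * \<kappa> * norm (fst (0::'a, - z))"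
      by (intro tendsto_intros w)+
    from tendsto_le[OF _ this(2,1) ev] show "z = 0"
      by simp
  qed
qed

section \<open>Adding an affine map\<close>

text \<open>The sum rule for an affine summand is exact: \<open>T (x, y) = (x, y + B x + c)\<close> is a bi-Lipschitz shear of the graph,
and normals are transported by the adjoint of its inverse, which sends \<open>(w, - z)\<close> to \<open>(w + B' z, - z)\<close>.\<close>

lemma coderivative_affine_sum:
  fixes F :: "'a::euclidean_space \<Rightarrow> 'b::euclidean_space set"
  assumes w: "w \<in> coderivative F x y z"
    and B: "bounded_linear B" and adj: "\<And>u v. inner (B' v) u = inner v (B u)"
    and F': "\<And>x. F' x = (\<lambda>y. y + B x + c) ` F x"
  shows "w + B' z \<in> coderivative F' x (y + B x + c) z"
proof -
  interpret B: bounded_linear B by (rule B)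
  define T where "T p = (fst p, snd p + B (fst p) + c)" for p :: "'a \<times> 'b"
  obtain K where K: "\<And>x. norm (B x) \<le> norm x * K" "K > 0"
    using B.pos_bounded by blast
  have gph: "gph F' = T ` gph F"
    unfolding gph_def F' T_def by (force simp: image_iff)
  have dist_T: "norm (p - q) \<le> (2 + K) * norm (T p - T q)" for p q
  proof -
    let ?dx = "fst p - fst q" and ?dy = "snd p - snd q"
    have *: "norm ?dx \<le> norm (T p - T q)" "norm (?dy + B ?dx) \<le> norm (T p - T q)"
      using norm_fst_le[of "fst (T p - T q)" "snd (T p - T q)"]
        norm_snd_le[of "snd (T p - T q)" "fst (T p - T q)"]
      by (simp_all add: T_def B.diff algebra_simps)
    have "norm (p - q) \<le> norm ?dx + norm ?dy"
      by (metis fst_diff norm_Pair_le prod.collapse snd_diff)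
    also have "norm ?dy \<le> norm (?dy + B ?dx) + norm (B ?dx)"
      by (metis add_diff_cancel_right' norm_triangle_ineq4)
    also have "norm (B ?dx) \<le> K * norm (T p - T q)"
      using K(1)[of ?dx] mult_right_mono[OF *(1), of K] K(2)
      by (simp only: mult.commute[of K] less_imp_le order_trans)
    finally show ?thesis
      using * by (simp add: algebra_simps)
  qed
  have reg: "(a + B' (- e), e) \<in> regular_normal_cone (gph F') (T p)"
    if "(a, e) \<in> regular_normal_cone (gph F) p" for a e p
    unfolding regular_normal_cone_iff
  proof (intro conjI allI impI)
    show "T p \<in> gph F'"
      using that by (auto simp: regular_normal_cone_iff gph)
    fix \<epsilon> :: real assume \<epsilon>: "\<epsilon> > 0"
    define \<delta> where "\<delta> = \<epsilon> / (2 + K)"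
    have "\<delta> > 0" using \<epsilon> K(2) by (simp add: \<delta>_def)
    then have "\<forall>\<^sub>F q in nhds p. q \<in> gph F \<longrightarrow> inner (a, e) (q - p) \<le> \<delta> * norm (q - p)"
      using that by (simp add: regular_normal_cone_iff)
    then obtain r where r: "r > 0" "\<And>q. dist q p < r \<Longrightarrow> q \<in> gph F \<Longrightarrow>
        inner (a, e) (q - p) \<le> \<delta> * norm (q - p)"
      unfolding eventually_nhds_metric by blast
    have "inner (a + B' (- e), e) (T q - T p) \<le> \<epsilon> * norm (T q - T p)"
      if q: "q \<in> gph F" "dist (T q) (T p) < r / (2 + K)" for q
    proof -
      have "norm (q - p) < r"
        using dist_T[of q p] q(2) K(2) by (simp add: dist_norm field_simps)
      then have "inner (a, e) (q - p) \<le> \<delta> * norm (q - p)"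
        using r(2) q(1) by (simp add: dist_norm)
      also have "\<dots> \<le> \<delta> * ((2 + K) * norm (T q - T p))"
        using \<open>\<delta> > 0\<close> by (intro mult_left_mono dist_T) auto
      also have "\<dots> = \<epsilon> * norm (T q - T p)"
        using K(2) by (simp add: \<delta>_def)
      finally show ?thesis
        by (simp add: T_def adj B.diff inner_prod_def inner_add_left inner_add_right inner_diff_right)
    qed
    then show "\<forall>\<^sub>F q in nhds (T p). q \<in> gph F' \<longrightarrow>
        inner (a + B' (- e), e) (q - T p) \<le> \<epsilon> * norm (q - T p)"
      unfolding eventually_nhds_metric gph using r(1) K(2)
      by (intro exI[of _ "r / (2 + K)"]) auto
  qed
  have B'_lin: "B' v = (\<Sum>i\<in>Basis. inner v (B i) *\<^sub>R i)" for v
    using euclidean_representation[of "B' v"] by (simp add: adj)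
  have cont: "(\<lambda>k. B' (f k)) \<longlonglongrightarrow> B' l" if "f \<longlonglongrightarrow> l" for f :: "nat \<Rightarrow> 'b" and l
    unfolding B'_lin by (intro tendsto_intros that)
  obtain p n where p: "p \<longlonglongrightarrow> (x, y)" "\<And>k. p k \<in> gph F" and n: "n \<longlonglongrightarrow> (w, - z)"
    and pn: "\<And>k::nat. n k \<in> regular_normal_cone (gph F) (p k)" and xy: "(x, y) \<in> gph F"
    using w unfolding coderivative_def limiting_normal_cone_def by auto
  have Tp: "(\<lambda>k. T (p k)) \<longlonglongrightarrow> T (x, y)"
    unfolding T_def by (intro tendsto_intros p B.tendsto)
  have "(\<lambda>k. (fst (n k) + B' (- snd (n k)), snd (n k))) \<longlonglongrightarrow>
      (fst (w, - z) + B' (- snd (w, - z)), snd (w, - z))"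
    by (intro tendsto_intros cont n)
  then have "(w + B' z, - z) \<in> limiting_normal_cone (gph F') (T (x, y))"
    unfolding limiting_normal_cone_def using Tp xy p(2) reg pn
    by (intro CollectI conjI exI[of _ "\<lambda>k. T (p k)"]
      exI[of _ "\<lambda>k. (fst (n k) + B' (- snd (n k)), snd (n k))"]) (auto simp: gph)
  then show ?thesis
    by (simp add: coderivative_def T_def)
qed


section \<open>Subgradients of the absolute value\<close>

text \<open>The convex subdifferential of the absolute value, written so that its graph is visibly closed.\<close>

definition abs_subgrad :: "real \<Rightarrow> real \<Rightarrow> bool" where
  "abs_subgrad t q \<longleftrightarrow> \<bar>q\<bar> \<le> 1 \<and> q * t = \<bar>t\<bar>"

lemma abs_subgrad_ineq: "abs_subgrad t q \<Longrightarrow> \<bar>t\<bar> + q * (t' - t) \<le> \<bar>t'\<bar>"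
proof -
  assume *: "abs_subgrad t q"
  have "q * t' \<le> \<bar>q\<bar> * \<bar>t'\<bar>"
    by (metis abs_ge_self abs_mult)
  also have "\<dots> \<le> 1 * \<bar>t'\<bar>"
    using * by (intro mult_right_mono) (auto simp: abs_subgrad_def)
  finally show ?thesis
    using * by (simp add: abs_subgrad_def right_diff_distrib)
qed

lemma abs_subgrad_iff: "abs_subgrad t q \<longleftrightarrow> (if t = 0 then \<bar>q\<bar> \<le> 1 else q = sgn t)"
proof (cases "t = 0")
  case False
  then have "q * t = \<bar>t\<bar> \<longleftrightarrow> q = sgn t"
    by (auto simp: sgn_if abs_if minus_equation_iff
        intro: mult_right_cancel[THEN iffD1, of t q "-1"])
  then show ?thesis
    using False by (auto simp: abs_subgrad_def sgn_if)
qed (simp add: abs_subgrad_def)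

text \<open>The inequality with error \<open>e |h|\<close> says that \<open>q / c\<close> is a Frechet subgradient of the absolute value; by
convexity such a vector is a convex subgradient. Here it is enough to compare one-sided slopes at \<open>t\<close>.\<close>

lemma abs_subgrad_of_first_order:
  fixes t c :: real
  assumes c: "c > 0"
    and ev: "\<And>e. e > 0 \<Longrightarrow> \<forall>\<^sub>F h in nhds 0. q * h \<le> c * (\<bar>t + h\<bar> - \<bar>t\<bar>) + e * \<bar>h\<bar>"
  shows "abs_subgrad t (q / c)"
proof -
  have slope: "s * q \<le> c * l" if l: "\<And>h. 0 \<le> h \<Longrightarrow> h < r \<Longrightarrow> \<bar>t + s * h\<bar> - \<bar>t\<bar> \<le> l * h"
    and s: "\<bar>s\<bar> = 1" and r: "r > 0" for s l r
  proof (rule field_le_epsilon)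
    fix e :: real assume "e > 0"
    then obtain d where d: "d > 0" "\<And>h. \<bar>h\<bar> < d \<Longrightarrow> q * h \<le> c * (\<bar>t + h\<bar> - \<bar>t\<bar>) + e * \<bar>h\<bar>"
      using ev unfolding eventually_nhds_metric by (auto simp: dist_real_def)
    define h where "h = min (d / 2) (r / 2)"
    have h: "h > 0" "h < d" "h < r"
      using d(1) r by (auto simp: h_def)
    have "q * (s * h) \<le> c * (\<bar>t + s * h\<bar> - \<bar>t\<bar>) + e * h"
      using d(2)[of "s * h"] h s by (simp add: abs_mult)
    also have "\<dots> \<le> c * (l * h) + e * h"
      using l[of h] h c by simp
    finally have "h * (s * q) \<le> h * (c * l + e)"
      by (simp add: algebra_simps)
    then show "s * q \<le> c * l + e"
      using h(1) by simp
  qed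
  show ?thesis
  proof (cases "t = 0")
    case True
    have "1 * q \<le> c * 1" "(-1) * q \<le> c * 1"
      by (rule slope[where r = 1]; simp add: True)+
    then show ?thesis
      using c True by (simp add: abs_subgrad_iff abs_le_iff field_simps)
  next
    case False
    have "1 * q \<le> c * sgn t" "(-1) * q \<le> c * (- sgn t)"
      by (rule slope[where r = "\<bar>t\<bar>"]; use False in \<open>auto simp: sgn_if\<close>)+
    then show ?thesis
      using c False by (auto simp: abs_subgrad_iff field_simps)
  qed
qed

lemma closed_abs_subgrad:
  assumes "t \<longlonglongrightarrow> t0" "q \<longlonglongrightarrow> q0" "\<forall>\<^sub>F k in sequentially. abs_subgrad (t k) (q k)"
  shows "abs_subgrad t0 q0"
  unfolding abs_subgrad_def
proof
  show "\<bar>q0\<bar> \<le> 1"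
    by (rule tendsto_le[OF _ tendsto_const tendsto_rabs[OF assms(2)]])
      (use assms(3) in \<open>auto simp: abs_subgrad_def elim: eventually_mono\<close>)
  have "\<forall>\<^sub>F k in sequentially. \<bar>t k\<bar> = q k * t k"
    using assms(3) by (auto simp: abs_subgrad_def elim: eventually_mono)
  then have "(\<lambda>k. q k * t k) \<longlonglongrightarrow> \<bar>t0\<bar>"
    using tendsto_rabs[OF assms(1)] by (simp add: tendsto_cong)
  moreover have "(\<lambda>k. q k * t k) \<longlonglongrightarrow> q0 * t0"
    by (intro tendsto_intros assms)
  ultimately show "q0 * t0 = \<bar>t0\<bar>"
    using LIMSEQ_unique by blast
qed

section \<open>The subdifferential of the objective\<close>

definition phi_real :: "real ^ 'n ^ 'm \<Rightarrow> real ^ 'm \<Rightarrow> real \<Rightarrow> real \<Rightarrow> real ^ 'n \<Rightarrow> real" where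
  "phi_real A b \<mu>1 \<mu>2 x = 1 / 2 * (norm (A *v x - b))\<^sup>2 + \<mu>1 * l1_norm x - \<mu>2 * (norm x)\<^sup>2"

lemma phi_fun_eq: "phi_fun A b \<mu>1 \<mu>2 x = ereal (phi_real A b \<mu>1 \<mu>2 x)"
  by (simp add: phi_fun_def phi_real_def)

lemma g_fun_eq: "g_fun \<mu>1 \<mu>2 = phi_fun (0 :: real ^ 'n ^ 'n) 0 \<mu>1 \<mu>2"
  by (rule ext) (simp add: g_fun_def phi_fun_def)

definition smooth_gradient :: "real ^ 'n ^ 'm \<Rightarrow> real ^ 'm \<Rightarrow> real \<Rightarrow> real ^ 'n \<Rightarrow> real ^ 'n" where
  "smooth_gradient A b \<mu>2 x = transpose A *v (A *v x - b) - (2 * \<mu>2) *\<^sub>R x"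

text \<open>The vector \<open>q\<close> with \<open>v = \<nabla>h(x) + \<mu>1 q\<close>, where \<open>h\<close> is the quadratic part of \<open>\<phi>\<close>.\<close>

definition l1_multiplier ::
  "real ^ 'n ^ 'm \<Rightarrow> real ^ 'm \<Rightarrow> real \<Rightarrow> real \<Rightarrow> real ^ 'n \<Rightarrow> real ^ 'n \<Rightarrow> real ^ 'n" where
  "l1_multiplier A b \<mu>1 \<mu>2 x v = (1 / \<mu>1) *\<^sub>R (v - smooth_gradient A b \<mu>2 x)"

lemma inner_transpose_mult: "inner (transpose A *v y) x = inner y (A *v x)"
  for A :: "real ^ 'n ^ 'm"
  by (simp add: dot_lmul_matrix)

lemma phi_real_expand:
  "phi_real A b \<mu>1 \<mu>2 x' = phi_real A b \<mu>1 \<mu>2 x + \<mu>1 * (l1_norm x' - l1_norm x)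
     + inner (smooth_gradient A b \<mu>2 x) (x' - x)
     + (1 / 2 * (norm (A *v (x' - x)))\<^sup>2 - \<mu>2 * (norm (x' - x))\<^sup>2)"
proof -
  define h where "h = x' - x"
  have x': "x' = x + h" by (simp add: h_def)
  have "A *v x' - b = (A *v x - b) + A *v h"
    by (simp add: x' matrix_vector_right_distrib)
  then have 1: "(norm (A *v x' - b))\<^sup>2 = (norm (A *v x - b))\<^sup>2
      + 2 * inner (transpose A *v (A *v x - b)) h + (norm (A *v h))\<^sup>2"
    by (simp only: power2_norm_eq_inner inner_add_left inner_add_right inner_transpose_mult
        inner_commute[of "A *v h" "A *v x - b"])
  have 2: "(norm x')\<^sup>2 = (norm x)\<^sup>2 + 2 * inner x h + (norm h)\<^sup>2"
    by (simp add: x' power2_norm_eq_inner inner_add inner_commute)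
  show ?thesis
    unfolding phi_real_def 1 2 h_def[symmetric]
    by (simp add: smooth_gradient_def inner_diff_left algebra_simps)
qed

lemma continuous_phi_real: "continuous_on UNIV (phi_real A b \<mu>1 \<mu>2)"
  unfolding phi_real_def l1_norm_def
  by (intro continuous_intros)

text \<open>Only the concave part \<open>- \<mu>2 |x|\<^sup>2\<close> violates convexity, and its second-order remainder is exactly
\<open>- \<mu>2 |x' - x|\<^sup>2\<close>. This inequality gives prox-regularity, the easy inclusion for the subdifferential,
and the properties of the proximal mapping.\<close>

lemma phi_real_subgradient_ineq:
  assumes "\<mu>1 > 0" and q: "\<And>i. abs_subgrad (x $ i) (l1_multiplier A b \<mu>1 \<mu>2 x v $ i)"
  shows "phi_real A b \<mu>1 \<mu>2 x' \<ge> phi_real A b \<mu>1 \<mu>2 x + inner v (x' - x) - \<mu>2 * (norm (x' - x))\<^sup>2"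
proof -
  let ?q = "l1_multiplier A b \<mu>1 \<mu>2 x v"
  have v: "v = smooth_gradient A b \<mu>2 x + \<mu>1 *\<^sub>R ?q"
    using assms(1) by (simp add: l1_multiplier_def)
  have "inner ?q (x' - x) \<le> (\<Sum>i\<in>UNIV. \<bar>x' $ i\<bar> - \<bar>x $ i\<bar>)"
    unfolding inner_vec_def
  proof (rule sum_mono)
    fix i show "inner (?q $ i) ((x' - x) $ i) \<le> \<bar>x' $ i\<bar> - \<bar>x $ i\<bar>"
      using abs_subgrad_ineq[OF q, of i "x' $ i"] by simp
  qed
  then have "inner ?q (x' - x) \<le> l1_norm x' - l1_norm x"
    by (simp add: l1_norm_def sum_subtractf)
  then have "\<mu>1 * inner ?q (x' - x) \<le> \<mu>1 * (l1_norm x' - l1_norm x)"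
    using assms(1) by simp
  moreover have "inner v (x' - x) = inner (smooth_gradient A b \<mu>2 x) (x' - x) + \<mu>1 * inner ?q (x' - x)"
    by (subst v) (simp add: inner_add_left)
  moreover have "0 \<le> (norm (A *v (x' - x)))\<^sup>2" by simp
  ultimately show ?thesis
    unfolding phi_real_expand[of A b \<mu>1 \<mu>2 x' x] by linarith
qed

lemma limiting_subdifferential_ereal:
  "limiting_subdifferential (\<lambda>x. ereal (f x)) x =
    {v. (v, -1) \<in> limiting_normal_cone {(x, \<alpha>). f x \<le> \<alpha>} (x, f x)}"
  by (simp add: limiting_subdifferential_def effective_domain_def epi_def)

lemma subgradient_of_multiplier:
  assumes "\<mu>1 > 0" "\<mu>2 > 0" and q: "\<And>i. abs_subgrad (x $ i) (l1_multiplier A b \<mu>1 \<mu>2 x v $ i)"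
  shows "v \<in> limiting_subdifferential (phi_fun A b \<mu>1 \<mu>2) x"
proof -
  let ?f = "phi_real A b \<mu>1 \<mu>2" and ?E = "{(x, \<alpha>). phi_real A b \<mu>1 \<mu>2 x \<le> \<alpha>}"
  have "(v, -1) \<in> regular_normal_cone ?E (x, ?f x)"
    unfolding regular_normal_cone_iff
  proof (intro conjI allI impI)
    fix e :: real assume e: "e > 0"
    have "inner (v, -1) (z - (x, ?f x)) \<le> e * norm (z - (x, ?f x))"
      if z: "dist z (x, ?f x) < e / \<mu>2" "z \<in> ?E" for z
    proof -
      obtain x' \<alpha> where z': "z = (x', \<alpha>)" by fastforce
      define h where "h = norm (z - (x, ?f x))"
      have h: "norm (x' - x) \<le> h" "h < e / \<mu>2"
        using norm_fst_le[of "x' - x" "\<alpha> - ?f x"] z(1) by (auto simp: h_def z' dist_norm)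
      have "inner (v, -1) (z - (x, ?f x)) = inner v (x' - x) - (\<alpha> - ?f x)"
        by (simp add: z')
      also have "\<dots> \<le> \<mu>2 * (norm (x' - x))\<^sup>2"
        using phi_real_subgradient_ineq[OF assms(1) q, of x'] z(2) by (simp add: z')
      also have "\<dots> \<le> \<mu>2 * h\<^sup>2"
        using assms(2) h(1) by (simp add: power_mono)
      also have "\<dots> = (\<mu>2 * h) * h"
        by (simp add: power2_eq_square)
      also have "\<dots> \<le> e * h"
        using h assms(2) by (intro mult_right_mono) (auto simp: field_simps h_def)
      finally show ?thesis by (simp add: h_def)
    qed
    then show "\<forall>\<^sub>F z in nhds (x, ?f x). z \<in> ?E \<longrightarrow>
        inner (v, -1) (z - (x, ?f x)) \<le> e * norm (z - (x, ?f x))"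
      unfolding eventually_nhds_metric using e assms(2) by (intro exI[of _ "e / \<mu>2"]) auto
  qed simp
  then have "(v, -1) \<in> limiting_normal_cone ?E (x, ?f x)"
    unfolding limiting_normal_cone_def
    by (intro CollectI conjI exI[of _ "\<lambda>_. (x, ?f x)"] exI[of _ "\<lambda>_. (v, -1)"]) auto
  then show ?thesis
    by (simp add: phi_fun_eq[abs_def] limiting_subdifferential_ereal)
qed

text \<open>The normal inequality is tested along the curve \<open>h \<mapsto> (x + h e\<^sub>i, \<alpha> + \<phi>(x + h e\<^sub>i) - \<phi>(x))\<close>. It stays in the epigraph
whenever its starting point \<open>(x, \<alpha>)\<close> is there, so points above the graph of \<open>\<phi>\<close> need no separate treatment.\<close>

lemma multiplier_of_regular_normal:
  fixes x :: "real ^ 'n"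
  assumes \<mu>: "\<mu>1 > 0" "\<mu>2 > 0" and \<beta>: "\<beta> > 0"
    and n: "(w, - \<beta>) \<in> regular_normal_cone {(x, \<alpha>). phi_real A b \<mu>1 \<mu>2 x \<le> \<alpha>} (x, \<alpha>)"
  shows "abs_subgrad (x $ i) (l1_multiplier A b \<mu>1 \<mu>2 x ((1 / \<beta>) *\<^sub>R w) $ i)"
proof -
  let ?f = "phi_real A b \<mu>1 \<mu>2" and ?E = "{(x, \<alpha>). phi_real A b \<mu>1 \<mu>2 x \<le> \<alpha>}"
  let ?g = "smooth_gradient A b \<mu>2 x"
  define C where "C = 1 / 2 * (norm (A *v axis i 1))\<^sup>2"
  define p where "p h = (x + h *\<^sub>R axis i 1, \<alpha> + (?f (x + h *\<^sub>R axis i 1) - ?f x))" for h :: real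
  have f_diff: "?f (x + h *\<^sub>R axis i 1) - ?f x
      = \<mu>1 * (\<bar>x $ i + h\<bar> - \<bar>x $ i\<bar>) + h * ?g $ i + (C - \<mu>2) * h\<^sup>2" for h
  proof -
    have "l1_norm (x + h *\<^sub>R axis i 1) - l1_norm x
        = (\<Sum>j\<in>UNIV. if j = i then \<bar>x $ i + h\<bar> - \<bar>x $ i\<bar> else 0)"
      unfolding l1_norm_def sum_subtractf[symmetric] by (intro sum.cong) (auto simp: axis_def)
    then have "l1_norm (x + h *\<^sub>R axis i 1) - l1_norm x = \<bar>x $ i + h\<bar> - \<bar>x $ i\<bar>"
      by simp
    note l1 = arg_cong[OF this, of "(*) \<mu>1"]
    show ?thesis
      using l1 unfolding phi_real_expand[of A b \<mu>1 \<mu>2 "x + h *\<^sub>R axis i 1" x]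
      by (simp add: C_def inner_axis matrix_vector_mult_scaleR power_mult_distrib algebra_simps)
  qed
  \<comment> \<open>a Lipschitz constant of the curve on \<open>[-1, 1]\<close>\<close>
  define L where "L = \<mu>1 + \<bar>?g $ i\<bar> + (C + \<mu>2) + 1"
  have C: "C \<ge> 0" by (simp add: C_def)
  have L: "L > 0" using \<mu> C by (simp add: L_def add_pos_nonneg add_nonneg_pos)
  have p_dist: "norm (p h - (x, \<alpha>)) \<le> L * \<bar>h\<bar>" if h: "\<bar>h\<bar> \<le> 1" for h
  proof -
    have "\<bar>\<mu>1 * (\<bar>x $ i + h\<bar> - \<bar>x $ i\<bar>)\<bar> \<le> \<mu>1 * \<bar>h\<bar>"
      using \<mu> by (simp add: abs_mult)
    moreover have "\<bar>(C - \<mu>2) * h\<^sup>2\<bar> \<le> (C + \<mu>2) * \<bar>h\<bar>"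
      unfolding abs_mult using h C \<mu> mult_left_mono[OF h, of "\<bar>h\<bar>"]
      by (intro mult_mono) (auto simp: power2_eq_square)
    moreover have "\<bar>h * ?g $ i\<bar> = \<bar>?g $ i\<bar> * \<bar>h\<bar>"
      by (simp add: abs_mult)
    ultimately have "\<bar>?f (x + h *\<^sub>R axis i 1) - ?f x\<bar> \<le> (\<mu>1 + \<bar>?g $ i\<bar> + (C + \<mu>2)) * \<bar>h\<bar>"
      unfolding f_diff distrib_right
      by (intro order_trans[OF abs_triangle_ineq] add_mono) simp_all
    moreover have "norm (p h - (x, \<alpha>)) \<le> norm (h *\<^sub>R axis i (1::real) :: real ^ 'n) + \<bar>?f (x + h *\<^sub>R axis i 1) - ?f x\<bar>"
      using norm_Pair_le[of "h *\<^sub>R axis i (1::real) :: real ^ 'n" "?f (x + h *\<^sub>R axis i 1) - ?f x"]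
      by (simp add: p_def)
    ultimately show ?thesis
      by (simp add: L_def algebra_simps)
  qed
  have p_lim: "(p \<longlongrightarrow> (x, \<alpha>)) (nhds 0)"
  proof -
    have "\<forall>\<^sub>F h in nhds (0::real). norm (p h - (x, \<alpha>)) \<le> L * \<bar>h\<bar>"
      unfolding eventually_nhds_metric
      by (intro exI[of _ 1]) (auto intro: p_dist)
    moreover have "((\<lambda>h. L * \<bar>h\<bar>) \<longlongrightarrow> L * \<bar>0\<bar>) (nhds (0::real))"
      by (intro tendsto_intros filterlim_ident)
    ultimately have "((\<lambda>h. p h - (x, \<alpha>)) \<longlongrightarrow> 0) (nhds 0)"
      by (auto dest: Lim_null_comparison)
    then show ?thesis
      by (rule Lim_null[THEN iffD2])
  qed
  have p_E: "p h \<in> ?E" for h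
    using n by (simp add: p_def regular_normal_cone_iff)
  define \<rho> where "\<rho> = w $ i / \<beta> - ?g $ i"
  have "abs_subgrad (x $ i) (\<rho> / \<mu>1)"
  proof (rule abs_subgrad_of_first_order[OF \<mu>(1)])
    fix e :: real assume e: "e > 0"
    \<comment> \<open>half of \<open>e\<close> goes into the normal inequality, the other half absorbs the quadratic term\<close>
    define e' where "e' = e * \<beta> / (2 * L)"
    have e': "e' > 0" using e \<beta> L by (simp add: e'_def)
    have "\<forall>\<^sub>F z in nhds (x, \<alpha>). z \<in> ?E \<longrightarrow> inner (w, - \<beta>) (z - (x, \<alpha>)) \<le> e' * norm (z - (x, \<alpha>))"
      using n e' by (simp add: regular_normal_cone_iff)
    then have "\<forall>\<^sub>F h in nhds 0. p h \<in> ?E \<longrightarrow> inner (w, - \<beta>) (p h - (x, \<alpha>)) \<le> e' * norm (p h - (x, \<alpha>))"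
      using p_lim unfolding filterlim_iff by blast
    moreover have "\<forall>\<^sub>F h in nhds (0::real). \<bar>h\<bar> < min 1 (e / (2 * (C + 1)))"
      unfolding eventually_nhds_metric using e C
      by (intro exI[of _ "min 1 (e / (2 * (C + 1)))"]) auto
    ultimately show "\<forall>\<^sub>F h in nhds 0. \<rho> * h \<le> \<mu>1 * (\<bar>x $ i + h\<bar> - \<bar>x $ i\<bar>) + e * \<bar>h\<bar>"
    proof eventually_elim
      fix h :: real
      assume *: "p h \<in> ?E \<longrightarrow> inner (w, - \<beta>) (p h - (x, \<alpha>)) \<le> e' * norm (p h - (x, \<alpha>))"
        and h: "\<bar>h\<bar> < min 1 (e / (2 * (C + 1)))"
      have "w $ i * h - \<beta> * (?f (x + h *\<^sub>R axis i 1) - ?f x) \<le> e' * norm (p h - (x, \<alpha>))"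
        using *[rule_format, OF p_E] by (simp add: p_def inner_axis mult.commute)
      also have "\<dots> \<le> e' * (L * \<bar>h\<bar>)"
        using h e' by (intro mult_left_mono p_dist) auto
      also have "\<dots> = \<beta> * (e / 2 * \<bar>h\<bar>)"
        using L by (simp add: e'_def)
      finally have "w $ i * h / \<beta> - (?f (x + h *\<^sub>R axis i 1) - ?f x) \<le> e / 2 * \<bar>h\<bar>"
        using \<beta> by (simp add: field_simps)
      moreover have "(C - \<mu>2) * h\<^sup>2 \<le> e / 2 * \<bar>h\<bar>"
      proof -
        have "\<bar>h\<bar> * (2 * (C + 1)) \<le> e"
          using h C by (simp add: pos_less_divide_eq less_imp_le)
        then have "(C + 1) * \<bar>h\<bar> \<le> e / 2" by (simp add: algebra_simps)
        then have "((C + 1) * \<bar>h\<bar>) * \<bar>h\<bar> \<le> e / 2 * \<bar>h\<bar>"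
          by (rule mult_right_mono) simp
        moreover have "(C - \<mu>2) * h\<^sup>2 \<le> (C + 1) * h\<^sup>2"
          using \<mu> by (intro mult_right_mono) auto
        moreover have "h\<^sup>2 = \<bar>h\<bar> * \<bar>h\<bar>"
          by (simp add: power2_eq_square)
        ultimately show ?thesis
          by (simp only: mult.assoc) 
      qed
      moreover have "\<rho> * h = w $ i * h / \<beta> - h * ?g $ i"
        by (simp add: \<rho>_def algebra_simps)
      ultimately show "\<rho> * h \<le> \<mu>1 * (\<bar>x $ i + h\<bar> - \<bar>x $ i\<bar>) + e * \<bar>h\<bar>"
        unfolding f_diff by linarith
    qed
  qed
  then show ?thesis
    by (simp add: l1_multiplier_def \<rho>_def)
qed

lemma tendsto_matrix_vector_mult [tendsto_intros]:
  fixes B :: "real ^ 'n ^ 'm"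
  shows "(y \<longlongrightarrow> y0) F \<Longrightarrow> ((\<lambda>k. B *v y k) \<longlongrightarrow> B *v y0) F"
  by (rule bounded_linear.tendsto[OF matrix_vector_mul_bounded_linear])

lemma tendsto_l1_multiplier [tendsto_intros]:
  assumes "(x \<longlongrightarrow> x0) F" "(v \<longlongrightarrow> v0) F"
  shows "((\<lambda>k. l1_multiplier A b \<mu>1 \<mu>2 (x k) (v k)) \<longlongrightarrow> l1_multiplier A b \<mu>1 \<mu>2 x0 v0) F"
  unfolding l1_multiplier_def smooth_gradient_def by (intro tendsto_intros assms)

text \<open>For the inclusion from left to right, the normals that approximate \<open>(v, -1)\<close> are rescaled to have last component
\<open>-1\<close>; their multipliers are subgradients coordinatewise, and this survives the limit.\<close>

proposition limiting_subdifferential_phi_fun: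
  assumes \<mu>: "\<mu>1 > 0" "\<mu>2 > 0"
  shows "v \<in> limiting_subdifferential (phi_fun A b \<mu>1 \<mu>2) x \<longleftrightarrow>
    (\<forall>i. abs_subgrad (x $ i) (l1_multiplier A b \<mu>1 \<mu>2 x v $ i))"
proof
  assume "v \<in> limiting_subdifferential (phi_fun A b \<mu>1 \<mu>2) x"
  then obtain p n where p: "p \<longlonglongrightarrow> (x, phi_real A b \<mu>1 \<mu>2 x)" and n: "n \<longlonglongrightarrow> (v, -1)"
    and reg: "\<And>k::nat. n k \<in> regular_normal_cone {(x, \<alpha>). phi_real A b \<mu>1 \<mu>2 x \<le> \<alpha>} (p k)"
    unfolding phi_fun_eq[abs_def] limiting_subdifferential_ereal limiting_normal_cone_def by auto
  define \<beta> where "\<beta> k = - snd (n k)" for k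
  have \<beta>: "\<beta> \<longlonglongrightarrow> 1"
    using tendsto_minus[OF tendsto_snd[OF n]] by (simp add: \<beta>_def[abs_def])
  have x: "(\<lambda>k. fst (p k)) \<longlonglongrightarrow> x" and w: "(\<lambda>k. fst (n k)) \<longlonglongrightarrow> v"
    using tendsto_fst[OF p] tendsto_fst[OF n] by simp_all
  have v: "(\<lambda>k. (1 / \<beta> k) *\<^sub>R fst (n k)) \<longlonglongrightarrow> (1 / 1) *\<^sub>R v"
    by (intro tendsto_intros \<beta> w) simp
  have ev: "\<forall>\<^sub>F k in sequentially. \<beta> k > 0"
    using order_tendstoD(1)[OF \<beta>] by simp
  show "\<forall>i. abs_subgrad (x $ i) (l1_multiplier A b \<mu>1 \<mu>2 x v $ i)"
  proof (intro allI closed_abs_subgrad)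
    fix i
    show "(\<lambda>k. fst (p k) $ i) \<longlonglongrightarrow> x $ i"
      by (intro tendsto_intros x)
    show "(\<lambda>k. l1_multiplier A b \<mu>1 \<mu>2 (fst (p k)) ((1 / \<beta> k) *\<^sub>R fst (n k)) $ i)
        \<longlonglongrightarrow> l1_multiplier A b \<mu>1 \<mu>2 x v $ i"
      using v by (intro tendsto_intros x) simp
    show "\<forall>\<^sub>F k in sequentially. abs_subgrad (fst (p k) $ i)
        (l1_multiplier A b \<mu>1 \<mu>2 (fst (p k)) ((1 / \<beta> k) *\<^sub>R fst (n k)) $ i)"
      using ev
    proof (rule eventually_mono)
      fix k assume "\<beta> k > 0"
      then show "abs_subgrad (fst (p k) $ i)
          (l1_multiplier A b \<mu>1 \<mu>2 (fst (p k)) ((1 / \<beta> k) *\<^sub>R fst (n k)) $ i)"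
        by (rule multiplier_of_regular_normal[OF \<mu>, where \<alpha> = "snd (p k)"])
          (use reg[of k] in \<open>simp add: \<beta>_def\<close>)
    qed
  qed
qed (use subgradient_of_multiplier[OF \<mu>] in blast)


section \<open>Local geometry of the graph\<close>

text \<open>The graph of the subdifferential of the absolute value lies on the lines \<open>t = 0\<close>, \<open>q = 1\<close> and \<open>q = -1\<close>. A point
near \<open>(t0, q0)\<close> can be on one of them only if \<open>(t0, q0)\<close> is on it. These implications are all that is used
about being close to \<open>(t0, q0)\<close>.\<close>

lemma eventually_same_abs_piece:
  fixes t0 q0 :: real
  shows "\<forall>\<^sub>F p in nhds (t0, q0). (fst p = 0 \<longrightarrow> t0 = 0) \<and> (\<bar>snd p\<bar> = 1 \<longrightarrow> snd p = q0)"
proof (rule eventually_conj)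
  have fst: "(fst \<longlongrightarrow> t0) (nhds (t0, q0))" and snd: "(snd \<longlongrightarrow> q0) (nhds (t0, q0))"
    by (auto intro: tendsto_eq_intros filterlim_ident)
  show "\<forall>\<^sub>F p in nhds (t0, q0). fst p = 0 \<longrightarrow> t0 = 0"
  proof (cases "t0 = 0")
    case False
    show ?thesis
      using tendsto_imp_eventually_ne[OF fst False] by eventually_elim simp
  qed simp
  show "\<forall>\<^sub>F p in nhds (t0, q0). \<bar>snd p\<bar> = 1 \<longrightarrow> snd p = q0"
  proof (cases "\<bar>q0\<bar> = 1")
    case True
    have "\<forall>\<^sub>F p in nhds (t0, q0). dist (snd p) q0 < 1"
      using tendstoD[OF snd, of 1] by simp
    then show ?thesis
      by eventually_elim (use True in \<open>auto simp: dist_real_def\<close>)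
  next
    case False
    then show ?thesis
      using tendsto_imp_eventually_ne[OF tendsto_rabs[OF snd], of 1] by (auto elim: eventually_mono)
  qed
qed

text \<open>If \<open>t \<noteq> t0\<close>, then \<open>(t, q)\<close> is on a horizontal ray away from its corner, and nearby points of the graph have the
same \<open>q\<close>; if \<open>q \<noteq> q0\<close>, it is inside the vertical segment, and nearby points have the same \<open>t\<close>. So
the rotated vector \<open>(q - q0, t0 - t)\<close> is orthogonal to the graph near \<open>(t, q)\<close>.\<close>

lemma abs_subgrad_locally_segment:
  assumes pq: "abs_subgrad t q" and t0: "t = 0 \<Longrightarrow> t0 = 0" and q0: "\<bar>q\<bar> = 1 \<Longrightarrow> q = q0"
  shows "\<forall>\<^sub>F p in nhds (t, q). abs_subgrad (fst p) (snd p) \<longrightarrow>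
    (q - q0) * (fst p - t) + (t0 - t) * (snd p - q) = 0"
proof (cases "t = 0")
  case True
  have snd: "(snd \<longlongrightarrow> q) (nhds (t, q))"
    by (auto intro: tendsto_eq_intros filterlim_ident)
  show ?thesis
  proof (cases "\<bar>q\<bar> = 1")
    case False
    then have "\<bar>q\<bar> < 1"
      using pq by (simp add: abs_subgrad_def)
    then have "\<forall>\<^sub>F p in nhds (t, q). \<bar>snd p\<bar> < 1"
      using order_tendstoD(2)[OF tendsto_rabs[OF snd]] by simp
    then show ?thesis
      by eventually_elim (use True t0 in \<open>auto simp: abs_subgrad_iff sgn_if split: if_splits\<close>)
  qed (use True t0 q0 in simp)
next
  case False
  have fst: "((\<lambda>p. t * fst p) \<longlongrightarrow> t * t) (nhds (t, q))"
    by (intro tendsto_mult tendsto_const) (auto intro: tendsto_eq_intros filterlim_ident)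
  have ev: "\<forall>\<^sub>F p in nhds (t, q). t * fst p > 0"
    by (rule order_tendstoD(1)[OF fst]) (use False in \<open>auto simp: zero_less_mult_iff\<close>)
  have "\<bar>q\<bar> = 1" and q: "q = sgn t"
    using False pq by (auto simp: abs_subgrad_iff sgn_if)
  show ?thesis
    using ev
  proof (rule eventually_mono, intro impI)
    fix p assume *: "t * fst p > 0" "abs_subgrad (fst p) (snd p)" 
    then have "snd p = q"
      by (auto simp: abs_subgrad_iff q sgn_if zero_less_mult_iff split: if_splits)
    then show "(q - q0) * (fst p - t) + (t0 - t) * (snd p - q) = 0"
      using q0[OF \<open>\<bar>q\<bar> = 1\<close>] by simp
  qed
qed

lemma abs_subgrad_scaling:
  assumes pq: "abs_subgrad t q" and t0: "t = 0 \<Longrightarrow> t0 = 0" and q0: "\<bar>q\<bar> = 1 \<Longrightarrow> q = q0"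
  shows "\<forall>\<^sub>F h in nhds (0::real). abs_subgrad (t + h * (t - t0)) (q + h * (q - q0))"
proof (cases "t = 0")
  case True
  have lim: "((\<lambda>h. \<bar>q + h * (q - q0)\<bar>) \<longlongrightarrow> \<bar>q + 0 * (q - q0)\<bar>) (nhds 0)"
    by (intro tendsto_intros filterlim_ident)
  show ?thesis
  proof (cases "\<bar>q\<bar> = 1")
    case False
    then have "\<bar>q + 0 * (q - q0)\<bar> < 1"
      using pq by (simp add: abs_subgrad_def)
    from order_tendstoD(2)[OF lim this] show ?thesis
      by eventually_elim (use True t0 in \<open>auto simp: abs_subgrad_iff\<close>)
  qed (use True t0 q0 in \<open>simp add: abs_subgrad_iff\<close>)
next
  case False
  have lim: "((\<lambda>h. t * (t + h * (t - t0))) \<longlongrightarrow> t * (t + 0 * (t - t0))) (nhds 0)"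
    by (intro tendsto_intros filterlim_ident)
  have "\<bar>q\<bar> = 1" and q: "q = sgn t"
    using False pq by (auto simp: abs_subgrad_iff sgn_if)
  have "t * (t + 0 * (t - t0)) > 0"
    using False by (auto simp: zero_less_mult_iff)
  from order_tendstoD(1)[OF lim this] show ?thesis
  proof (eventually_elim)
    fix h assume "0 < t * (t + h * (t - t0))"
    then have "sgn (t + h * (t - t0)) = sgn t" "t + h * (t - t0) \<noteq> 0"
      by (auto simp: sgn_if zero_less_mult_iff)
    then show "abs_subgrad (t + h * (t - t0)) (q + h * (q - q0))"
      using q0[OF \<open>\<bar>q\<bar> = 1\<close>] q by (auto simp: abs_subgrad_iff)
  qed
qed

lemma l1_multiplier_diff:
  fixes A :: "real ^ 'n ^ 'm"
  shows "\<mu>1 \<noteq> 0 \<Longrightarrow> \<mu>1 *\<^sub>R (l1_multiplier A b \<mu>1 \<mu>2 x v - l1_multiplier A b \<mu>1 \<mu>2 x' v') =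
    (v - v') - transpose A *v (A *v (x - x')) + (2 * \<mu>2) *\<^sub>R (x - x')"
  by (simp add: l1_multiplier_def smooth_gradient_def matrix_vector_mult_diff_distrib
      algebra_simps del: transpose_matrix_vector)

text \<open>The conclusion of \<open>eventually_same_abs_piece\<close> in every coordinate.\<close>

definition same_piece_near where
  "same_piece_near A b \<mu>1 \<mu>2 x0 v0 x v \<longleftrightarrow> (\<forall>i.
     (x $ i = 0 \<longrightarrow> x0 $ i = 0) \<and>
     (\<bar>l1_multiplier A b \<mu>1 \<mu>2 x v $ i\<bar> = 1 \<longrightarrow>
        l1_multiplier A b \<mu>1 \<mu>2 x v $ i = l1_multiplier A b \<mu>1 \<mu>2 x0 v0 $ i))"

lemma tendsto_coordinate:
  "((\<lambda>p. (fst p $ i, l1_multiplier A b \<mu>1 \<mu>2 (fst p) (snd p) $ i)) \<longlongrightarrow>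
    (x $ i, l1_multiplier A b \<mu>1 \<mu>2 x v $ i)) (nhds (x, v))"
proof -
  have "(fst \<longlongrightarrow> x) (nhds (x, v))" "(snd \<longlongrightarrow> v) (nhds (x, v))"
    by (auto intro: tendsto_eq_intros filterlim_ident)
  then show ?thesis
    by (intro tendsto_intros)
qed

lemma eventually_same_piece:
  "\<forall>\<^sub>F p in nhds (x0, v0). same_piece_near A b \<mu>1 \<mu>2 x0 v0 (fst p) (snd p)"
  unfolding same_piece_near_def
proof (rule eventually_all_finite)
  fix i
  show "\<forall>\<^sub>F p in nhds (x0, v0). (fst p $ i = 0 \<longrightarrow> x0 $ i = 0) \<and>
     (\<bar>l1_multiplier A b \<mu>1 \<mu>2 (fst p) (snd p) $ i\<bar> = 1 \<longrightarrow>
      l1_multiplier A b \<mu>1 \<mu>2 (fst p) (snd p) $ i = l1_multiplier A b \<mu>1 \<mu>2 x0 v0 $ i)"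
    using eventually_same_abs_piece tendsto_coordinate[of i A b \<mu>1 \<mu>2 x0 v0]
    unfolding filterlim_iff by fastforce
qed

text \<open>Written in terms of \<open>x\<close> and the multiplier, the inner product is the sum of the planar ones from
\<open>abs_subgrad_locally_segment\<close>: the contributions of the quadratic part cancel because its Hessian is symmetric.\<close>

lemma gph_locally_rotated_orthogonal:
  fixes A :: "real ^ 'n ^ 'm"
  assumes \<mu>: "\<mu>1 > 0" "\<mu>2 > 0"
    and xv: "v \<in> limiting_subdifferential (phi_fun A b \<mu>1 \<mu>2) x"
    and near: "same_piece_near A b \<mu>1 \<mu>2 x0 v0 x v"
  shows "\<forall>\<^sub>F p in nhds (x, v). p \<in> gph (limiting_subdifferential (phi_fun A b \<mu>1 \<mu>2)) \<longrightarrow>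
    inner (v - v0, x0 - x) (p - (x, v)) = 0"
proof -
  let ?q = "l1_multiplier A b \<mu>1 \<mu>2"
  have "\<forall>\<^sub>F p in nhds (x, v). \<forall>i. abs_subgrad (fst p $ i) (?q (fst p) (snd p) $ i) \<longrightarrow>
      (?q x v $ i - ?q x0 v0 $ i) * (fst p $ i - x $ i) +
      (x0 $ i - x $ i) * (?q (fst p) (snd p) $ i - ?q x v $ i) = 0"
  proof (rule eventually_all_finite)
    fix i
    have "abs_subgrad (x $ i) (?q x v $ i)"
      using xv by (simp add: limiting_subdifferential_phi_fun[OF \<mu>])
    from abs_subgrad_locally_segment[OF this, of "x0 $ i" "?q x0 v0 $ i"]
    show "\<forall>\<^sub>F p in nhds (x, v). abs_subgrad (fst p $ i) (?q (fst p) (snd p) $ i) \<longrightarrow>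
        (?q x v $ i - ?q x0 v0 $ i) * (fst p $ i - x $ i) +
        (x0 $ i - x $ i) * (?q (fst p) (snd p) $ i - ?q x v $ i) = 0"
      using near tendsto_coordinate[of i A b \<mu>1 \<mu>2 x v]
      unfolding same_piece_near_def filterlim_iff by fastforce
  qed
  then show ?thesis
  proof (rule eventually_mono, intro impI)
    fix p assume *: "\<forall>i. abs_subgrad (fst p $ i) (?q (fst p) (snd p) $ i) \<longrightarrow>
        (?q x v $ i - ?q x0 v0 $ i) * (fst p $ i - x $ i) +
        (x0 $ i - x $ i) * (?q (fst p) (snd p) $ i - ?q x v $ i) = 0"
      and p: "p \<in> gph (limiting_subdifferential (phi_fun A b \<mu>1 \<mu>2))"
    obtain x' v' where p': "p = (x', v')" by fastforce
    define k where "k = x' - x"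
    define e where "e = x0 - x"
    have "(?q x v $ i - ?q x0 v0 $ i) * (x' $ i - x $ i) +
        (x0 $ i - x $ i) * (?q x' v' $ i - ?q x v $ i) = 0" for i
      using * p by (simp add: p' gph_def limiting_subdifferential_phi_fun[OF \<mu>])
    then have "inner (?q x v - ?q x0 v0) k + inner e (?q x' v' - ?q x v) = 0"
      unfolding inner_vec_def sum.distrib[symmetric] by (simp add: k_def e_def)
    then have "inner (\<mu>1 *\<^sub>R (?q x v - ?q x0 v0)) k + inner e (\<mu>1 *\<^sub>R (?q x' v' - ?q x v)) = 0"
      unfolding inner_scaleR_left inner_scaleR_right distrib_left[symmetric] by simp
    moreover have "inner (transpose A *v (A *v (x - x0))) k = - inner e (transpose A *v (A *v k))"
    proof -
      have "x - x0 = - e" by (simp add: e_def)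
      then have "inner (transpose A *v (A *v (x - x0))) k = - inner (A *v e) (A *v k)"
        by (simp only: inner_transpose_mult) (simp add: linear_neg[OF matrix_vector_mul_linear])
      also have "\<dots> = - inner e (transpose A *v (A *v k))"
        by (metis inner_commute inner_transpose_mult)
      finally show ?thesis .
    qed
    moreover have "inner (x - x0) k = - inner e k"
      by (simp add: e_def inner_diff_left)
    ultimately show "inner (v - v0, x0 - x) (p - (x, v)) = 0"
      using \<mu> unfolding l1_multiplier_diff[OF less_imp_neq[OF \<mu>(1), symmetric]] p' k_def[symmetric] e_def[symmetric]
      by (simp add: inner_add inner_diff k_def[symmetric] e_def[symmetric] del: transpose_matrix_vector)
  qed
qed

text \<open>The Newton equation \<open>v0 - v \<in> D*S(x, v)(z)\<close> is solved by \<open>z = x0 - x\<close>, and its other solutions differ from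
this one by elements of the kernel of the coderivative (second part with \<open>w = v0 - v\<close>).\<close>

lemma coderivative_rotated_direction:
  fixes A :: "real ^ 'n ^ 'm" and b \<mu>1 \<mu>2
  defines "S \<equiv> limiting_subdifferential (phi_fun A b \<mu>1 \<mu>2)"
  assumes \<mu>: "\<mu>1 > 0" "\<mu>2 > 0" and xv: "v \<in> S x" and near: "same_piece_near A b \<mu>1 \<mu>2 x0 v0 x v"
  shows "v0 - v \<in> coderivative S x v (x0 - x)"
    and "w \<in> coderivative S x v z \<Longrightarrow> w + (v - v0) \<in> coderivative S x v (z - (x0 - x))"
proof -
  have orth: "\<forall>\<^sub>F p in nhds (x, v). p \<in> gph S \<longrightarrow> inner (v - v0, x0 - x) (p - (x, v)) = 0"
    using gph_locally_rotated_orthogonal[OF \<mu> xv[unfolded S_def] near] by (simp add: S_def)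
  have "\<forall>\<^sub>F p in nhds (x, v). p \<in> gph S \<longrightarrow> inner (- (v - v0, x0 - x)) (p - (x, v)) = 0"
    using orth by eventually_elim (simp only: inner_minus_left neg_equal_0_iff_equal)
  moreover have "(x, v) \<in> gph S"
    using xv by (simp add: gph_def)
  ultimately have "0 + - (v - v0, x0 - x) \<in> limiting_normal_cone (gph S) (x, v)"
    by (intro limiting_normal_cone_add_orthogonal zero_in_limiting_normal_cone)
  then show "v0 - v \<in> coderivative S x v (x0 - x)"
    by (simp add: coderivative_def)
  show "w + (v - v0) \<in> coderivative S x v (z - (x0 - x))" if "w \<in> coderivative S x v z"
    using limiting_normal_cone_add_orthogonal[OF that[unfolded coderivative_def, simplified] orth]
    by (simp add: coderivative_def algebra_simps)
qed

text \<open>The points considered are the images of \<open>(x, v)\<close> under scaling with centre \<open>(x0, v0)\<close> by factors close to 1. In each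
coordinate, \<open>(x, v)\<close> either agrees with the centre and stays fixed, or is interior to a piece of the planar curve
whose line passes through the centre, and then stays on this piece.\<close>

lemma gph_contains_segment:
  assumes \<mu>: "\<mu>1 > 0" "\<mu>2 > 0"
    and xv: "v \<in> limiting_subdifferential (phi_fun A b \<mu>1 \<mu>2) x"
    and near: "same_piece_near A b \<mu>1 \<mu>2 x0 v0 x v"
  shows "\<forall>\<^sub>F h in nhds (0::real). (x, v) + h *\<^sub>R ((x, v) - (x0, v0)) \<in>
    gph (limiting_subdifferential (phi_fun A b \<mu>1 \<mu>2))"
proof -
  let ?q = "l1_multiplier A b \<mu>1 \<mu>2"
  have q: "?q (x + h *\<^sub>R (x - x0)) (v + h *\<^sub>R (v - v0)) = ?q x v + h *\<^sub>R (?q x v - ?q x0 v0)" for h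
    by (simp add: l1_multiplier_def smooth_gradient_def matrix_vector_right_distrib
        matrix_vector_mult_diff_distrib matrix_vector_mult_scaleR algebra_simps del: transpose_matrix_vector)
  have "\<forall>\<^sub>F h in nhds (0::real). \<forall>i.
      abs_subgrad (x $ i + h * (x $ i - x0 $ i)) (?q x v $ i + h * (?q x v $ i - ?q x0 v0 $ i))"
    using near xv unfolding same_piece_near_def limiting_subdifferential_phi_fun[OF \<mu>]
    by (intro eventually_all_finite abs_subgrad_scaling) auto
  then show ?thesis
    by (rule eventually_mono) (simp add: gph_def limiting_subdifferential_phi_fun[OF \<mu>] q)
qed

text \<open>A directional normal in the direction \<open>d\<close> is a limit of regular normals at points \<open>p\<close> for which \<open>p - (x0, v0)\<close> is
a multiple of a direction close to \<open>d\<close>. The graph contains a segment through \<open>p\<close> in this direction, so these regular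
normals are orthogonal to it.\<close>

lemma semismooth_star_phi:
  assumes \<mu>: "\<mu>1 > 0" "\<mu>2 > 0" and xv0: "v0 \<in> limiting_subdifferential (phi_fun A b \<mu>1 \<mu>2) x0"
  shows "semismooth_star_at (limiting_subdifferential (phi_fun A b \<mu>1 \<mu>2)) x0 v0"
proof -
  let ?S = "limiting_subdifferential (phi_fun A b \<mu>1 \<mu>2)"
  have "inner n d = 0" if n: "n \<in> directional_normal_cone (gph ?S) (x0, v0) d" for n d
  proof -
    obtain t e w where t: "\<And>k. t k > 0" "t \<longlonglongrightarrow> 0" and e: "e \<longlonglongrightarrow> d" and w: "w \<longlonglongrightarrow> n"
      and reg: "\<And>k::nat. w k \<in> regular_normal_cone (gph ?S) ((x0, v0) + t k *\<^sub>R e k)"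
      using n unfolding directional_normal_cone_def by auto
    have "(\<lambda>k. (x0, v0) + t k *\<^sub>R e k) \<longlonglongrightarrow> (x0, v0) + 0 *\<^sub>R d"
      by (intro tendsto_intros t e)
    then have "(\<lambda>k. (x0, v0) + t k *\<^sub>R e k) \<longlonglongrightarrow> (x0, v0)"
      by simp
    from eventually_compose_filterlim[OF eventually_same_piece this]
    have "\<forall>\<^sub>F k in sequentially. same_piece_near A b \<mu>1 \<mu>2 x0 v0
        (fst ((x0, v0) + t k *\<^sub>R e k)) (snd ((x0, v0) + t k *\<^sub>R e k))" .
    then have ev: "\<forall>\<^sub>F k in sequentially. inner (w k) (e k) = 0"
    proof (rule eventually_mono)
      fix k
      let ?p = "(x0, v0) + t k *\<^sub>R e k"
      assume "same_piece_near A b \<mu>1 \<mu>2 x0 v0 (fst ?p) (snd ?p)"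
      moreover have "snd ?p \<in> ?S (fst ?p)"
        using reg[of k] by (simp add: regular_normal_cone_iff gph_def case_prod_beta)
      ultimately have "\<forall>\<^sub>F h in nhds (0::real).
          (fst ?p, snd ?p) + h *\<^sub>R ((fst ?p, snd ?p) - (x0, v0)) \<in> gph ?S"
        by (intro gph_contains_segment[OF \<mu>])
      then have "\<forall>\<^sub>F h in nhds (0::real). ?p + h *\<^sub>R (t k *\<^sub>R e k) \<in> gph ?S"
        by (simp only: prod.collapse add_diff_cancel_left')
      from regular_normal_orthogonal_to_line[OF reg this] show "inner (w k) (e k) = 0"
        using t(1)[of k] by simp
    qed
    have "(\<lambda>k. inner (w k) (e k)) \<longlonglongrightarrow> inner n d"
      by (intro tendsto_intros w e)
    from LIMSEQ_unique[OF this tendsto_eventually[OF ev]] show ?thesis .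
  qed
  then have "inner (u', - v') (u, v) = 0"
    if "(u', - v') \<in> directional_normal_cone (gph ?S) (x0, v0) (u, v)" for u v u' v'
    using that by blast
  then show ?thesis
    using xv0 unfolding semismooth_star_at_def gph_def directional_coderivative_def by auto
qed


section \<open>Prox-regularity and the proximal mapping\<close>

lemma continuously_prox_regular_phi_fun:
  assumes \<mu>: "\<mu>1 > 0" "\<mu>2 > 0" and v0: "v0 \<in> limiting_subdifferential (phi_fun A b \<mu>1 \<mu>2) x0"
  shows "continuously_prox_regular_at (phi_fun A b \<mu>1 \<mu>2) x0 v0"
proof -
  have cont: "isCont (phi_real A b \<mu>1 \<mu>2) x" for x
    using continuous_phi_real[of A b \<mu>1 \<mu>2] by (simp add: continuous_on_eq_continuous_at)
  have dom: "x0 \<in> effective_domain (phi_fun A b \<mu>1 \<mu>2)"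
    by (simp add: effective_domain_def phi_fun_eq)
  have "phi_fun A b \<mu>1 \<mu>2 x \<le> Liminf (at x) (phi_fun A b \<mu>1 \<mu>2)" for x
  proof -
    have "(phi_fun A b \<mu>1 \<mu>2 \<longlongrightarrow> phi_fun A b \<mu>1 \<mu>2 x) (at x)"
      unfolding phi_fun_eq[abs_def] using cont[of x] by (intro tendsto_intros) (simp add: isCont_def)
    then show ?thesis
      by (simp add: lim_imp_Liminf[OF at_neq_bot])
  qed
  then have "lsc_around (phi_fun A b \<mu>1 \<mu>2) x0"
    unfolding lsc_around_def by (intro exI[of _ UNIV]) simp
  moreover have "phi_fun A b \<mu>1 \<mu>2 x \<ge> phi_fun A b \<mu>1 \<mu>2 u
      + ereal (inner v (x - u) - 2 * \<mu>2 / 2 * (norm (x - u))\<^sup>2)"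
    if "v \<in> limiting_subdifferential (phi_fun A b \<mu>1 \<mu>2) u" for x u v
    using phi_real_subgradient_ineq[OF \<mu>(1), of u A b \<mu>2 v x] that
    by (simp add: limiting_subdifferential_phi_fun[OF \<mu>] phi_fun_eq)
  ultimately have "prox_regular_at (phi_fun A b \<mu>1 \<mu>2) x0 v0"
    unfolding prox_regular_at_def using dom v0 \<mu>(2)
    by (intro conjI exI[of _ "2 * \<mu>2"] exI[of _ "1::real"]) auto
  moreover have "subdifferentially_continuous_at (phi_fun A b \<mu>1 \<mu>2) x0 v0"
    unfolding subdifferentially_continuous_at_def phi_fun_eq[abs_def]
    using dom v0 isCont_tendsto_compose[OF cont]
    by (auto simp: phi_fun_eq[abs_def] intro!: tendsto_intros)
  ultimately show ?thesis
    by (simp add: continuously_prox_regular_at_def)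
qed

lemma prox_bounded_g_fun:
  assumes "\<mu>1 > 0"
  shows "prox_bounded (g_fun \<mu>1 \<mu>2)"
  unfolding prox_bounded_def
proof (intro exI conjI allI)
  show "linear (\<lambda>x. (- \<mu>2) *\<^sub>R x)"
    by (rule linear_scaleR)
  fix x :: "real ^ 'a"
  have "0 \<le> \<mu>1 * l1_norm x"
    using assms by (simp add: l1_norm_def sum_nonneg)
  then show "ereal (inner ((- \<mu>2) *\<^sub>R x) x + inner 0 x + 0) \<le> g_fun \<mu>1 \<mu>2 x"
    by (simp add: g_fun_def power2_norm_eq_inner)
qed

text \<open>For \<open>\<gamma> < 1 / (2 \<mu>2)\<close> the proximal term dominates the concave part of \<open>g\<close>, so the first-order condition at
\<open>v\<close> implies quadratic growth of the objective around \<open>v\<close>.\<close>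

lemma Prox_g_fun_unique:
  fixes u v :: "real ^ 'n"
  assumes \<mu>: "\<mu>1 > 0" "\<mu>2 > 0" and \<gamma>: "0 < \<gamma>" "\<gamma> < 1 / (2 * \<mu>2)"
    and y: "(1 / \<gamma>) *\<^sub>R (u - v) \<in> limiting_subdifferential (g_fun \<mu>1 \<mu>2) v"
  shows "Prox \<gamma> (g_fun \<mu>1 \<mu>2) u = {v}"
proof -
  let ?f = "phi_real (0 :: real ^ 'n ^ 'n) 0 \<mu>1 \<mu>2"
  let ?h = "\<lambda>y. ?f y + 1 / (2 * \<gamma>) * (norm (y - u))\<^sup>2"
  have c: "1 / (2 * \<gamma>) - \<mu>2 > 0"
    using \<gamma> \<mu> by (simp add: field_simps)
  have growth: "?h v + (1 / (2 * \<gamma>) - \<mu>2) * (norm (x - v))\<^sup>2 \<le> ?h x" for x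
  proof -
    have f: "?f x \<ge> ?f v + inner ((1 / \<gamma>) *\<^sub>R (u - v)) (x - v) - \<mu>2 * (norm (x - v))\<^sup>2"
      using y by (intro phi_real_subgradient_ineq[OF \<mu>(1)])
        (simp add: g_fun_eq limiting_subdifferential_phi_fun[OF \<mu>])
    define k where "k = x - v"
    have "x - u = k - (u - v)" by (simp add: k_def)
    then have "(norm (x - u))\<^sup>2 = (norm k)\<^sup>2 - 2 * inner (u - v) k + (norm (v - u))\<^sup>2"
      by (simp only: norm_minus_commute[of v u]) (simp add: power2_norm_eq_inner inner_diff_left inner_diff_right inner_commute)
    then have "1 / (2 * \<gamma>) * (norm (x - u))\<^sup>2 = 1 / (2 * \<gamma>) * (norm k)\<^sup>2
        - inner ((1 / \<gamma>) *\<^sub>R (u - v)) k + 1 / (2 * \<gamma>) * (norm (v - u))\<^sup>2"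
      unfolding inner_scaleR_left using \<gamma>(1) by (simp add: field_simps)
    then show ?thesis
      using f unfolding k_def[symmetric] left_diff_distrib by linarith
  qed
  have obj: "g_fun \<mu>1 \<mu>2 y + ereal (1 / (2 * \<gamma>) * (norm (y - u))\<^sup>2) = ereal (?h y)" for y
    by (simp add: g_fun_eq phi_fun_eq)
  show ?thesis
  proof (intro equalityI subsetI)
    fix y assume "y \<in> Prox \<gamma> (g_fun \<mu>1 \<mu>2) u"
    then have "?h y \<le> ?h v"
      unfolding Prox_def obj is_arg_min_linorder by simp
    then have "(1 / (2 * \<gamma>) - \<mu>2) * (norm (y - v))\<^sup>2 \<le> 0"
      using growth[of y] by linarith
    then show "y \<in> {v}"
      using c by (simp add: mult_le_0_iff)
  next
    fix y assume y: "y \<in> {v}"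
    have "?h v \<le> ?h x" for x
      using growth[of x] mult_nonneg_nonneg[OF less_imp_le[OF c] zero_le_power2[of "norm (x - v)"]]
      by linarith
    then show "y \<in> Prox \<gamma> (g_fun \<mu>1 \<mu>2) u"
      using y unfolding Prox_def obj is_arg_min_linorder by simp
  qed
qed

lemma prox_point_exists:
  fixes u :: "real ^ 'n"
  assumes \<mu>: "\<mu>1 > 0" "\<mu>2 > 0" and \<gamma>: "0 < \<gamma>" "\<gamma> < 1 / (2 * \<mu>2)"
  shows "\<exists>v. (1 / \<gamma>) *\<^sub>R (u - v) \<in> limiting_subdifferential (g_fun \<mu>1 \<mu>2) v"
proof -
  define c where "c = 1 - 2 * \<gamma> * \<mu>2"
  have c: "c > 0" using \<gamma> \<mu> by (simp add: c_def field_simps)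
  \<comment> \<open>soft thresholding, followed by the scaling that undoes the concave quadratic\<close>
  define v :: "real ^ 'n" where "v = (\<chi> i. sgn (u $ i) * max 0 (\<bar>u $ i\<bar> - \<gamma> * \<mu>1) / c)"
  have q: "l1_multiplier (0 :: real ^ 'n ^ 'n) 0 \<mu>1 \<mu>2 v ((1 / \<gamma>) *\<^sub>R (u - v)) $ i
      = (u $ i - c * v $ i) / (\<gamma> * \<mu>1)" for i
    using \<mu> \<gamma> by (simp add: l1_multiplier_def smooth_gradient_def c_def field_simps)
  have cv: "c * v $ i = sgn (u $ i) * max 0 (\<bar>u $ i\<bar> - \<gamma> * \<mu>1)" for i
    using c by (simp add: v_def)
  have gm: "\<gamma> * \<mu>1 > 0" using \<gamma> \<mu> by simp
  have "abs_subgrad (v $ i) ((u $ i - c * v $ i) / (\<gamma> * \<mu>1))" for i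
  proof (cases "\<bar>u $ i\<bar> \<le> \<gamma> * \<mu>1")
    case True
    then have "v $ i = 0" by (simp add: v_def)
    then show ?thesis
      using True gm by (simp add: abs_subgrad_iff)
  next
    case False
    then have "u $ i \<noteq> 0" using gm by auto
    moreover have "sgn (v $ i) = sgn (u $ i)"
      using False c by (simp add: v_def sgn_mult sgn_divide)
    moreover have "u $ i - c * v $ i = sgn (u $ i) * (\<gamma> * \<mu>1)"
      unfolding cv using False by (simp add: sgn_if)
    moreover have "v $ i \<noteq> 0"
      using calculation(1,2) by (metis sgn_eq_0_iff)
    ultimately show ?thesis
      using \<mu> \<gamma> by (simp add: abs_subgrad_iff)
  qed
  then have "(1 / \<gamma>) *\<^sub>R (u - v) \<in> limiting_subdifferential (g_fun \<mu>1 \<mu>2) v"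
    by (simp add: g_fun_eq limiting_subdifferential_phi_fun[OF \<mu>] q)
  then show ?thesis by blast
qed

text \<open>The subdifferential of \<open>g\<close> is monotone up to the defect \<open>2 \<mu>2\<close>; this is seen by adding the subgradient
inequalities at the two points.\<close>

lemma prox_point_lipschitz:
  fixes u v u' v' :: "real ^ 'n"
  assumes \<mu>: "\<mu>1 > 0" "\<mu>2 > 0" and \<gamma>: "0 < \<gamma>" "\<gamma> < 1 / (2 * \<mu>2)"
    and v: "(1 / \<gamma>) *\<^sub>R (u - v) \<in> limiting_subdifferential (g_fun \<mu>1 \<mu>2) v"
    and v': "(1 / \<gamma>) *\<^sub>R (u' - v') \<in> limiting_subdifferential (g_fun \<mu>1 \<mu>2) v'"
  shows "(1 - 2 * \<gamma> * \<mu>2) * norm (v - v') \<le> norm (u - u')"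
proof (cases "v = v'")
  case False
  let ?f = "phi_real (0 :: real ^ 'n ^ 'n) 0 \<mu>1 \<mu>2"
  define k where "k = v - v'"
  have "?f v' \<ge> ?f v + inner ((1 / \<gamma>) *\<^sub>R (u - v)) (v' - v) - \<mu>2 * (norm (v' - v))\<^sup>2"
    using v by (intro phi_real_subgradient_ineq[OF \<mu>(1)])
      (simp add: g_fun_eq limiting_subdifferential_phi_fun[OF \<mu>])
  moreover have "?f v \<ge> ?f v' + inner ((1 / \<gamma>) *\<^sub>R (u' - v')) (v - v') - \<mu>2 * (norm (v - v'))\<^sup>2"
    using v' by (intro phi_real_subgradient_ineq[OF \<mu>(1)])
      (simp add: g_fun_eq limiting_subdifferential_phi_fun[OF \<mu>])
  moreover have "inner ((1 / \<gamma>) *\<^sub>R (u - v)) (v' - v) + inner ((1 / \<gamma>) *\<^sub>R (u' - v')) (v - v')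
      = - ((1 / \<gamma>) * (inner (u - u') k - (norm k)\<^sup>2))"
    by (simp add: k_def power2_norm_eq_inner inner_diff_left inner_diff_right algebra_simps)
  ultimately have "0 \<le> (1 / \<gamma>) * (inner (u - u') k - (norm k)\<^sup>2) + 2 * \<mu>2 * (norm k)\<^sup>2"
    by (simp add: k_def norm_minus_commute)
  then have "0 \<le> \<gamma> * ((1 / \<gamma>) * (inner (u - u') k - (norm k)\<^sup>2) + 2 * \<mu>2 * (norm k)\<^sup>2)"
    using \<gamma>(1) by (intro mult_nonneg_nonneg) auto
  also have "\<dots> = inner (u - u') k - (1 - 2 * \<gamma> * \<mu>2) * (norm k)\<^sup>2"
    using \<gamma>(1) by (simp add: algebra_simps)
  finally have "((1 - 2 * \<gamma> * \<mu>2) * norm k) * norm k \<le> inner (u - u') k"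
    by (simp add: power2_eq_square)
  also have "\<dots> \<le> norm (u - u') * norm k"
    by (rule norm_cauchy_schwarz)
  finally show ?thesis
    using False by (simp add: k_def)
qed simp

lemma coderivative_g_to_phi:
  fixes A :: "real ^ 'n ^ 'm"
  assumes \<mu>: "\<mu>1 > 0" "\<mu>2 > 0"
    and w: "w \<in> second_subdifferential (g_fun \<mu>1 \<mu>2) x y z"
  shows "w + transpose A *v (A *v z) \<in>
    coderivative (limiting_subdifferential (phi_fun A b \<mu>1 \<mu>2)) x (y + transpose A *v (A *v x) - transpose A *v b) z"
proof -
  let ?B = "\<lambda>x. transpose A *v (A *v x)"
  have blin: "bounded_linear ?B"
    by (intro bounded_linear_compose[OF matrix_vector_mul_bounded_linear] matrix_vector_mul_bounded_linear)
  have adj: "inner (?B v) u = inner v (?B u)" for u v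
    by (metis inner_commute inner_transpose_mult)
  have shift: "y \<in> limiting_subdifferential (phi_fun A b \<mu>1 \<mu>2) x \<longleftrightarrow>
      y - ?B x + transpose A *v b \<in> limiting_subdifferential (g_fun \<mu>1 \<mu>2) x" for x y
    by (simp add: g_fun_eq limiting_subdifferential_phi_fun[OF \<mu>] l1_multiplier_def
        smooth_gradient_def matrix_vector_mult_diff_distrib algebra_simps del: transpose_matrix_vector)
  have "limiting_subdifferential (phi_fun A b \<mu>1 \<mu>2) x =
      (\<lambda>y. y + ?B x + - (transpose A *v b)) ` limiting_subdifferential (g_fun \<mu>1 \<mu>2) x" for x
  proof (intro set_eqI iffI)
    fix y assume "y \<in> limiting_subdifferential (phi_fun A b \<mu>1 \<mu>2) x"
    then show "y \<in> (\<lambda>y. y + ?B x + - (transpose A *v b)) ` limiting_subdifferential (g_fun \<mu>1 \<mu>2) x"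
      unfolding shift by (intro image_eqI[of _ _ "y - ?B x + transpose A *v b"]) auto
  qed (auto simp: shift simp del: transpose_matrix_vector)
  from coderivative_affine_sum[OF w[unfolded second_subdifferential_def] blin adj this]
  show ?thesis by simp
qed


section \<open>The Newton step\<close>

lemma zero_of_subdifferential_locally_unique:
  assumes \<mu>: "\<mu>1 > 0" "\<mu>2 > 0"
    and x: "0 \<in> limiting_subdifferential (phi_fun A b \<mu>1 \<mu>2) x"
    and near: "same_piece_near A b \<mu>1 \<mu>2 x0 0 x 0"
    and kernel: "\<forall>z. 0 \<in> coderivative (limiting_subdifferential (phi_fun A b \<mu>1 \<mu>2)) x 0 z \<longrightarrow> z = 0"
  shows "x = x0"
proof -
  have "x0 - x = 0"
    using coderivative_rotated_direction(1)[OF \<mu> x near] kernel by (metis diff_self)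
  then show ?thesis by simp
qed

text \<open>The inclusion for \<open>g\<close> at \<open>(v, y)\<close> becomes the Newton equation \<open>- s \<in> \<partial>\<^sup>2\<phi>(v, s)(z)\<close> after the smooth least
squares part is added.\<close>

lemma newton_direction_unique:
  fixes A :: "real ^ 'n ^ 'm"
  assumes \<mu>: "\<mu>1 > 0" "\<mu>2 > 0"
    and near: "same_piece_near A b \<mu>1 \<mu>2 x0 0 v s"
    and kernel: "\<forall>z. 0 \<in> coderivative (limiting_subdifferential (phi_fun A b \<mu>1 \<mu>2)) v s z \<longrightarrow> z = 0"
    and s: "s = y + transpose A *v (A *v v) - transpose A *v b"
    and w: "w \<in> second_subdifferential (g_fun \<mu>1 \<mu>2) v y z"
    and newton: "w + transpose A *v (A *v z) = - s"
  shows "z = x0 - v"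
proof -
  let ?S = "limiting_subdifferential (phi_fun A b \<mu>1 \<mu>2)"
  have d: "- s \<in> coderivative ?S v s z"
    using coderivative_g_to_phi[OF \<mu> w, of A b] by (simp only: newton s[symmetric])
  then have "s \<in> ?S v"
    by (simp add: coderivative_def limiting_normal_cone_def gph_def)
  from coderivative_rotated_direction(2)[OF \<mu> this near d]
  have "0 \<in> coderivative ?S v s (z - (x0 - v))"
    by simp
  then have "z - (x0 - v) = 0"
    using kernel by blast
  then show ?thesis by simp
qed

text \<open>Here \<open>v\<close> is the proximal point and \<open>(v, s x v)\<close> the associated point of the graph of the subdifferential of \<open>\<phi>\<close>.
The unknown of the Newton equation is \<open>z = x - v + d\<close>, so its solution \<open>z = x0 - v\<close> gives \<open>x + d = x0\<close>. Solvability is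
proved for \<open>g\<close> directly, with the base point \<open>(x0, y x0 x0)\<close>, and uniqueness for \<open>\<phi>\<close>, where metric
regularity is available.\<close>

lemma newton_step_iff_solution:
  fixes A :: "real ^ 'n ^ 'm" and b :: "real ^ 'm" and \<mu>1 \<mu>2 \<gamma> :: real
  defines "S \<equiv> limiting_subdifferential (phi_fun A b \<mu>1 \<mu>2)"
  assumes \<mu>: "\<mu>1 > 0" "\<mu>2 > 0" and \<gamma>: "0 < \<gamma>" "\<gamma> < 1 / (2 * \<mu>2)"
  defines "y \<equiv> \<lambda>x v. (1 / \<gamma>) *\<^sub>R (x - \<gamma> *\<^sub>R (transpose A *v (A *v x) - transpose A *v b) - v)"
  defines "s \<equiv> \<lambda>x v. y x v + transpose A *v (A *v v) - transpose A *v b"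
  assumes v: "y x v \<in> limiting_subdifferential (g_fun \<mu>1 \<mu>2) v"
    and near_g: "same_piece_near (0 :: real ^ 'n ^ 'n) 0 \<mu>1 \<mu>2 x0 (y x0 x0) v (y x v)"
    and near: "same_piece_near A b \<mu>1 \<mu>2 x0 0 v (s x v)"
    and kernel: "\<forall>z. 0 \<in> coderivative S v (s x v) z \<longrightarrow> z = 0"
  shows "newton_step A b \<mu>1 \<mu>2 \<gamma> x x' \<longleftrightarrow> 0 \<notin> S x \<and> x' = x0"
proof -
  let ?u = "x - \<gamma> *\<^sub>R (transpose A *v (A *v x) - transpose A *v b)"
  let ?B = "\<lambda>x. transpose A *v (A *v x)"
  have B: "?B (a + c) = ?B a + ?B c" "?B (a - c) = ?B a - ?B c" for a c
    by (simp_all only: matrix_vector_right_distrib matrix_vector_mult_diff_distrib)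
  have y: "y x v = (1 / \<gamma>) *\<^sub>R (x - v) - (?B x - transpose A *v b)" for x v
    using \<gamma>(1) by (simp add: y_def algebra_simps del: transpose_matrix_vector)
  have prox: "Prox \<gamma> (g_fun \<mu>1 \<mu>2) ?u = {v}"
    using Prox_g_fun_unique[OF \<mu> \<gamma> v[unfolded y_def]] .
  have exists: "- ((1 / \<gamma>) *\<^sub>R (x - v)) - ?B (x0 - x)
      \<in> second_subdifferential (g_fun \<mu>1 \<mu>2) v (y x v) (x - v + (x0 - x))"
  proof -
    have "y x0 x0 - y x v = - ((1 / \<gamma>) *\<^sub>R (x - v)) - ?B (x0 - x)"
      unfolding y B by simp
    then show ?thesis
      using coderivative_rotated_direction(1)[OF \<mu> _ near_g] v
      by (simp add: second_subdifferential_def g_fun_eq del: transpose_matrix_vector)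
  qed
  have unique: "x + d = x0"
    if d: "- ((1 / \<gamma>) *\<^sub>R (x - v)) - ?B d
      \<in> second_subdifferential (g_fun \<mu>1 \<mu>2) v (y x v) (x - v + d)" for d
  proof -
    have "- ((1 / \<gamma>) *\<^sub>R (x - v)) - ?B d + ?B (x - v + d) = - s x v"
      unfolding s_def y B by simp
    from newton_direction_unique[OF \<mu> near kernel[unfolded S_def] _ d this]
    have "x - v + d = x0 - v"
      by (simp add: s_def del: transpose_matrix_vector)
    then show ?thesis by (simp add: algebra_simps)
  qed
  have step: "newton_step A b \<mu>1 \<mu>2 \<gamma> x x' \<longleftrightarrow> 0 \<notin> S x \<and>
      (\<exists>d. - ((1 / \<gamma>) *\<^sub>R (x - v)) - ?B d
        \<in> second_subdifferential (g_fun \<mu>1 \<mu>2) v (y x v) (x - v + d) \<and> x' = x + d)"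
    unfolding newton_step_def S_def[symmetric] y_def using prox by auto
  show ?thesis
    unfolding step using exists unique by (auto intro!: exI[of _ "x0 - x"] simp del: transpose_matrix_vector)
qed

text \<open>As \<open>x\<close> tends to \<open>x0\<close>, so does the proximal point \<open>v x\<close>, since \<open>x0\<close> is its own proximal point; and the associated
subgradient \<open>s x (v x)\<close> tends to \<open>0\<close>. So the local results at \<open>(x0, 0)\<close> apply along the algorithm.\<close>

lemma eventually_newton_step_iff:
  fixes A :: "real ^ 'n ^ 'm" and b :: "real ^ 'm" and \<mu>1 \<mu>2 \<gamma> :: real and x0 :: "real ^ 'n"
  defines "S \<equiv> limiting_subdifferential (phi_fun A b \<mu>1 \<mu>2)"
  assumes \<mu>: "\<mu>1 > 0" "\<mu>2 > 0" and \<gamma>: "0 < \<gamma>" "\<gamma> < 1 / (2 * \<mu>2)"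
    and x0: "0 \<in> S x0" and reg: "metrically_regular_around S x0 0"
  shows "\<forall>\<^sub>F x in nhds x0. (\<forall>x'. newton_step A b \<mu>1 \<mu>2 \<gamma> x x' \<longleftrightarrow> 0 \<notin> S x \<and> x' = x0)
    \<and> (0 \<in> S x \<longrightarrow> x = x0)"
proof (rule eventually_conj)
  let ?B = "\<lambda>x. transpose A *v (A *v x)"
  define u where "u x = x - \<gamma> *\<^sub>R (?B x - transpose A *v b)" for x
  define y where "y x v = (1 / \<gamma>) *\<^sub>R (u x - v)" for x v
  define s where "s x v = y x v + ?B v - transpose A *v b" for x v
  have good: "\<forall>\<^sub>F p in nhds (x0, 0). same_piece_near A b \<mu>1 \<mu>2 x0 0 (fst p) (snd p) \<and>
      (\<forall>z. 0 \<in> coderivative S (fst p) (snd p) z \<longrightarrow> z = 0)"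
    using eventually_conj[OF eventually_same_piece metrically_regular_coderivative_kernel[OF reg]] .
  have "((\<lambda>x. (x, 0)) \<longlongrightarrow> (x0, 0 :: real ^ 'n)) (nhds x0)"
    by (intro tendsto_intros filterlim_ident)
  from eventually_compose_filterlim[OF good this]
  show "\<forall>\<^sub>F x in nhds x0. 0 \<in> S x \<longrightarrow> x = x0"
    by eventually_elim
      (use zero_of_subdifferential_locally_unique[OF \<mu>] in \<open>auto simp: S_def\<close>)
  obtain P :: "real ^ 'n \<Rightarrow> real ^ 'n"
    where P: "\<And>w. (1 / \<gamma>) *\<^sub>R (w - P w) \<in> limiting_subdifferential (g_fun \<mu>1 \<mu>2) (P w)"
    using prox_point_exists[OF \<mu> \<gamma>] by metis
  define v where "v x = P (u x)" for x
  have vg: "y x (v x) \<in> limiting_subdifferential (g_fun \<mu>1 \<mu>2) (v x)" for x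
    using P by (simp add: y_def v_def)
  have y0: "y x0 x0 = - (?B x0) + transpose A *v b"
    using \<gamma>(1) by (simp add: y_def u_def del: transpose_matrix_vector)
  have y0g: "y x0 x0 \<in> limiting_subdifferential (g_fun \<mu>1 \<mu>2) x0"
    using x0 unfolding y0 S_def g_fun_eq limiting_subdifferential_phi_fun[OF \<mu>]
    by (simp add: l1_multiplier_def smooth_gradient_def matrix_vector_mult_diff_distrib
        algebra_simps del: transpose_matrix_vector)
  have u: "(u \<longlongrightarrow> u x0) (nhds x0)"
    unfolding u_def by (intro tendsto_intros filterlim_ident)
  have v: "(v \<longlongrightarrow> x0) (nhds x0)"
  proof -
    define c where "c = 1 - 2 * \<gamma> * \<mu>2"
    have c: "c > 0" using \<gamma> \<mu> by (simp add: c_def field_simps)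
    have "norm (v x - x0) \<le> norm (u x - u x0) / c" for x
      using prox_point_lipschitz[OF \<mu> \<gamma> vg[unfolded y_def] y0g[unfolded y_def], of x] c
      by (simp add: c_def pos_le_divide_eq mult.commute)
    then have ev: "\<forall>\<^sub>F x in nhds x0. norm (v x - x0) \<le> norm (u x - u x0) / c"
      by simp
    have "((\<lambda>x. norm (u x - u x0) / c) \<longlongrightarrow> norm (u x0 - u x0) / c) (nhds x0)"
      using c by (intro tendsto_intros u) simp
    then have "((\<lambda>x. norm (u x - u x0) / c) \<longlongrightarrow> 0) (nhds x0)"
      by simp
    from Lim_null_comparison[OF ev this] show ?thesis
      by (rule Lim_null[THEN iffD2])
  qed
  have y: "((\<lambda>x. y x (v x)) \<longlongrightarrow> y x0 x0) (nhds x0)"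
    unfolding y_def by (intro tendsto_intros u v)
  have "((\<lambda>x. s x (v x)) \<longlongrightarrow> s x0 x0) (nhds x0)"
    unfolding s_def by (intro tendsto_intros y v)
  moreover have "s x0 x0 = 0"
    by (simp add: s_def y0)
  ultimately have "((\<lambda>x. (v x, s x (v x))) \<longlongrightarrow> (x0, 0)) (nhds x0)"
    using v by (auto intro: tendsto_Pair)
  from eventually_compose_filterlim[OF good this]
    eventually_compose_filterlim[OF eventually_same_piece tendsto_Pair[OF v y]]
  show "\<forall>\<^sub>F x in nhds x0. \<forall>x'. newton_step A b \<mu>1 \<mu>2 \<gamma> x x' \<longleftrightarrow> 0 \<notin> S x \<and> x' = x0"
  proof eventually_elim
    fix x
    assume *: "same_piece_near A b \<mu>1 \<mu>2 x0 0 (fst (v x, s x (v x))) (snd (v x, s x (v x))) \<and>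
        (\<forall>z. 0 \<in> coderivative S (fst (v x, s x (v x))) (snd (v x, s x (v x))) z \<longrightarrow> z = 0)"
      and near_g: "same_piece_near (0 :: real ^ 'n ^ 'n) 0 \<mu>1 \<mu>2 x0 (y x0 x0)
        (fst (v x, y x (v x))) (snd (v x, y x (v x)))"
    show "\<forall>x'. newton_step A b \<mu>1 \<mu>2 \<gamma> x x' \<longleftrightarrow> 0 \<notin> S x \<and> x' = x0"
      using newton_step_iff_solution[OF \<mu> \<gamma>, where A = A and b = b and x = x and v = "v x" and ?x0.0 = x0] * near_g vg[of x]
      by (simp add: y_def u_def s_def S_def del: transpose_matrix_vector)
  qed
qed

theorem theorem8p5:
  fixes A :: "real ^ 'n ^ 'm" and b :: "real ^ 'm" and \<mu>1 \<mu>2 :: real and xbar :: "real ^ 'n"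
  assumes "\<mu>1 > 0" and "\<mu>2 > 0"
    and "0 \<in> limiting_subdifferential (phi_fun A b \<mu>1 \<mu>2) xbar"
    and "metrically_regular_around (limiting_subdifferential (phi_fun A b \<mu>1 \<mu>2)) xbar 0"
  shows
    "(prox_bounded (g_fun \<mu>1 \<mu>2 :: real ^ 'n \<Rightarrow> ereal) \<and>
      continuously_prox_regular_at (g_fun \<mu>1 \<mu>2) xbar
        (- (transpose A *v (A *v xbar)) + transpose A *v b) \<and>
      (\<exists>U' V'. open U' \<and> xbar \<in> U' \<and> open V' \<and> 0 \<in> V' \<and>
        (\<forall>(x, v) \<in> gph (limiting_subdifferential (phi_fun A b \<mu>1 \<mu>2)) \<inter> (U' \<times> V').
           \<exists>d. - v \<in> second_subdifferential (phi_fun A b \<mu>1 \<mu>2) x v d)) \<and>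
      semismooth_star_at (limiting_subdifferential (phi_fun A b \<mu>1 \<mu>2)) xbar 0)
     \<and>
     (\<forall>\<gamma>\<in>{0<..<1 / (2 * \<mu>2)}.
        invertible (mat 1 - \<gamma> *\<^sub>R (transpose A ** A)) \<longrightarrow>
        (\<exists>U. open U \<and> xbar \<in> U \<and>
          (\<forall>x0\<in>U. newton_well_defined A b \<mu>1 \<mu>2 \<gamma> x0 \<and>
                   newton_Q_superlinear A b \<mu>1 \<mu>2 \<gamma> xbar x0)))"
proof -
  let ?S = "limiting_subdifferential (phi_fun A b \<mu>1 \<mu>2)"
  note \<mu> = assms(1,2) and xbar = assms(3) and reg = assms(4)
  have "prox_bounded (g_fun \<mu>1 \<mu>2 :: real ^ 'n \<Rightarrow> ereal)"
    using prox_bounded_g_fun[OF \<mu>(1)] .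
  moreover have "continuously_prox_regular_at (g_fun \<mu>1 \<mu>2) xbar
        (- (transpose A *v (A *v xbar)) + transpose A *v b)"
    unfolding g_fun_eq
  proof (rule continuously_prox_regular_phi_fun[OF \<mu>])
    show "- (transpose A *v (A *v xbar)) + transpose A *v b
        \<in> limiting_subdifferential (phi_fun (0 :: real ^ 'n ^ 'n) 0 \<mu>1 \<mu>2) xbar"
      using xbar unfolding limiting_subdifferential_phi_fun[OF \<mu>]
      by (simp add: l1_multiplier_def smooth_gradient_def matrix_vector_mult_diff_distrib
          algebra_simps del: transpose_matrix_vector)
  qed
  moreover have "\<exists>U' V'. open U' \<and> xbar \<in> U' \<and> open V' \<and> 0 \<in> V' \<and>
        (\<forall>(x, v) \<in> gph ?S \<inter> (U' \<times> V').
           \<exists>d. - v \<in> second_subdifferential (phi_fun A b \<mu>1 \<mu>2) x v d)"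
  proof -
    obtain W where W: "open W" "(xbar, 0) \<in> W"
      "\<And>p. p \<in> W \<Longrightarrow> same_piece_near A b \<mu>1 \<mu>2 xbar 0 (fst p) (snd p)"
      using eventually_same_piece[of A b \<mu>1 \<mu>2 xbar 0] unfolding eventually_nhds by blast
    obtain U' V' where UV: "open U'" "open V'" "(xbar, 0) \<in> U' \<times> V'" "U' \<times> V' \<subseteq> W"
      using open_prod_elim[OF W(1,2)] by blast
    have "- v \<in> second_subdifferential (phi_fun A b \<mu>1 \<mu>2) x v (xbar - x)"
      if "v \<in> ?S x" "(x, v) \<in> U' \<times> V'" for x v
      using coderivative_rotated_direction(1)[OF \<mu> that(1), of xbar 0] W(3)[of "(x, v)"] UV(4) that(2)
      by (auto simp: second_subdifferential_def)
    then show ?thesis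
      using UV by (intro exI[of _ U'] exI[of _ V']) (auto simp: gph_def)
  qed
  moreover have "semismooth_star_at ?S xbar 0"
    using semismooth_star_phi[OF \<mu> xbar] .
  moreover have "\<exists>U. open U \<and> xbar \<in> U \<and>
      (\<forall>x0\<in>U. newton_well_defined A b \<mu>1 \<mu>2 \<gamma> x0 \<and> newton_Q_superlinear A b \<mu>1 \<mu>2 \<gamma> xbar x0)"
    if \<gamma>: "\<gamma> \<in> {0<..<1 / (2 * \<mu>2)}" for \<gamma>
  proof -
    obtain U where U: "open U" "xbar \<in> U"
      and step: "\<And>x x'. x \<in> U \<Longrightarrow> newton_step A b \<mu>1 \<mu>2 \<gamma> x x' \<longleftrightarrow> 0 \<notin> ?S x \<and> x' = xbar"
      and stop: "\<And>x. x \<in> U \<Longrightarrow> 0 \<in> ?S x \<Longrightarrow> x = xbar"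
      using eventually_newton_step_iff[OF \<mu> _ _ xbar reg, of \<gamma>] \<gamma> unfolding eventually_nhds by auto
    \<comment> \<open>runs from \<open>x0\<close> visit only \<open>x0\<close> and \<open>xbar\<close> and stop at the latest at \<open>xbar\<close>, so there are no infinite runs\<close>
    have no_step: "\<not> newton_step A b \<mu>1 \<mu>2 \<gamma> xbar x'" for x'
      using step[OF U(2)] xbar by simp
    have reach: "x = x0 \<or> x = xbar" if "(newton_step A b \<mu>1 \<mu>2 \<gamma>)\<^sup>*\<^sup>* x0 x" "x0 \<in> U" for x0 x
      using that by (induction rule: rtranclp_induct) (use step no_step in auto)
    have "newton_well_defined A b \<mu>1 \<mu>2 \<gamma> x0" if "x0 \<in> U" for x0
      unfolding newton_well_defined_def using reach[OF _ that] step[OF that] xbar by blast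
    moreover have "newton_Q_superlinear A b \<mu>1 \<mu>2 \<gamma> xbar x0" if "x0 \<in> U" for x0
      unfolding newton_Q_superlinear_def
    proof (intro conjI allI impI)
      show "x = xbar" if "(newton_step A b \<mu>1 \<mu>2 \<gamma>)\<^sup>*\<^sup>* x0 x" "0 \<in> ?S x" for x
        using reach[OF that(1) \<open>x0 \<in> U\<close>] stop \<open>x0 \<in> U\<close> that(2) by blast
      fix X assume X: "X 0 = x0" "\<forall>k. newton_step A b \<mu>1 \<mu>2 \<gamma> (X k) (X (Suc k))"
      then have "X 1 = xbar"
        using step[OF \<open>x0 \<in> U\<close>] by (metis One_nat_def)
      then show "Q_superlinearly_converges X xbar"
        using X(2) no_step by metis
    qed
    ultimately show ?thesis
      using U by blast
  qed
  ultimately show ?thesis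
    by blast
qed

end
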